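(* Let $0<p<1$ and let $\Lambda$ be chosen with probability $p$ from $\widetilde{\Lambda}=\bigcup_{k=1}^\infty\left(2^{-k}\mathbb{N}\cap[k,k+1)\right)$. Then almost surely $\Lambda$ is type $1$.
   Context: $\mathbb{N}=\{1,2,\dots\}$, and $2^{-k}\mathbb{N}=\{2^{-k}j: j\in\mathbb{N}\}$. Random choice: list the elements of $\widetilde{\Lambda}$ in increasing order, $\widetilde{\Lambda}=\{\lambda_1<\lambda_2<\dots\}$. Let $\Omega=\{0,1\}^{\mathbb{N}}$ with the product probability measure $\mathbb{P}$ of the measures on $\{0,1\}$ giving mass $p$ to $\{1\}$ and $1-p$ to $\{0\}$. For $\omega=(\omega_k)\in\Omega$ let $\Lambda_\omega=\{\lambda_k:\omega_k=1\}$ (each element of $\widetilde{\Lambda}$ is kept independently with probability $p$ and otherwise deleted). "$\Lambda$ is chosen with probability $p$ from $\widetilde{\Lambda}$" means $\Lambda=\Lambda_\omega$ is this random set, and a property holds almost surely if the set of those $\omega$ for which $\Lambda_\omega$ has the property has $\mathbb{P}$-measure $1$. (Almost surely $\Lambda_\omega$ is infinite.) Type: for an unbounded, infinite discrete set $\Lambda\subset[0,\infty)$ and a measurable $f:\mathbb{R}\to[0,+\infty)$ let $C(f,\Lambda)=\{x\in\mathbb{R}:\sum_{\lambda\in\Lambda}f(x+\lambda)<\infty\}$ and $D(f,\Lambda)=\{x\in\mathbb{R}:\sum_{\lambda\in\Lambda}f(x+\lambda)=\infty\}$. The set $\Lambda$ is type $1$ if for every such $f$ either $C(f,\Lambda)$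 has full Lebesgue measure in $\mathbb{R}$ or $C(f,\Lambda)$ has Lebesgue measure $0$; otherwise $\Lambda$ is type $2$. *)

theory Defs
  imports "HOL-Probability.Probability"
begin

text \<open>The set \<open>2\<^sup>-\<^sup>k \<nat>\<close>, where \<open>\<nat>\<close> starts at 1.\<close>

definition dyadic_grid :: "nat \<Rightarrow> real set" where
  "dyadic_grid k = {real j / 2 ^ k | j :: nat. j \<ge> 1}"

definition Lambda_tilde :: "real set" where
  "Lambda_tilde = (\<Union>k\<in>{1..}. dyadic_grid k \<inter> {real k..<real k + 1})"

text \<open>The library's \<open>enumerate\<close> needs a well-ordered type, so the increasing enumeration of a
  set of reals is introduced by description; \<open>increasing_enum_Lambda_tilde\<close> below shows that it
  is well defined for \<open>Lambda_tilde\<close>. Indices start at 0.\<close>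

definition increasing_enum :: "real set \<Rightarrow> nat \<Rightarrow> real" where
  "increasing_enum S = (THE l. strict_mono l \<and> range l = S)"

text \<open>The sample space \<open>{0,1}\<^sup>\<nat>\<close> with the product measure; \<open>True\<close> stands for 1 and
  has mass \<open>p\<close>. The coordinate \<open>\<omega> k\<close> decides about the element with (0-based) index \<open>k\<close>.\<close>

definition selection_measure :: "real \<Rightarrow> (nat \<Rightarrow> bool) measure" where
  "selection_measure p = PiM UNIV (\<lambda>_. measure_pmf (bernoulli_pmf p))"

definition selected :: "real set \<Rightarrow> (nat \<Rightarrow> bool) \<Rightarrow> real set" where
  "selected S \<omega> = {increasing_enum S k | k. \<omega> k}"

definition conv_set :: "(real \<Rightarrow> real) \<Rightarrow> real set \<Rightarrow> real set" where
  "conv_set f \<Lambda> = {x. (\<Sum>\<^sub>\<infinity>l\<in>\<Lambda>. ennreal (f (x + l))) < \<infinity>}"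

definition unbounded_discrete :: "real set \<Rightarrow> bool" where
  "unbounded_discrete \<Lambda> \<longleftrightarrow>
     \<Lambda> \<subseteq> {0..} \<and> infinite \<Lambda> \<and> \<not> bounded \<Lambda> \<and> topological_space_class.discrete \<Lambda>"

text \<open>The notion is only defined for unbounded, infinite discrete subsets of \<open>[0,\<infinity>)\<close>, so these
  conditions are part of the predicate: a finite set is not of type 1.\<close>

definition type1 :: "real set \<Rightarrow> bool" where
  "type1 \<Lambda> \<longleftrightarrow> unbounded_discrete \<Lambda> \<and>
     (\<forall>f :: real \<Rightarrow> real. f \<in> borel_measurable lebesgue \<and> (\<forall>x. f x \<ge> 0) \<longrightarrow>
        - conv_set f \<Lambda> \<in> null_sets lebesgue \<or> conv_set f \<Lambda> \<in> null_sets lebesgue)"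

lemma strict_mono_same_range_eq:
  fixes l m :: "nat \<Rightarrow> real"
  assumes l: "strict_mono l" and m: "strict_mono m" and r: "range l = range m"
  shows "l = m"
proof
  have le: "b n \<le> a n" if a: "strict_mono a" and b: "strict_mono b" and rg: "range a = range b"
    and IH: "\<And>k. k < n \<Longrightarrow> a k = b k" for a b :: "nat \<Rightarrow> real" and n
  proof -
    obtain j where j: "a n = b j" using rg by (metis rangeE rangeI)
    have "\<not> j < n" 
    proof
      assume "j < n"
      then have "a j = a n" using IH j by simp
      then show False using strict_monoD[OF a \<open>j < n\<close>] by simp
    qed
    then show ?thesis using j strict_mono_less_eq[OF b, of n j] by simp
  qed
  fix n show "l n = m n"
  proof (induction n rule: less_induct)
    case (less n)
    show ?case using le[OF l m r, of n] le[OF m l r[symmetric], of n] less by force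
  qed
qed

lemma increasing_enum_unique:
  fixes S :: "real set"
  assumes inf: "infinite S" and fin: "\<And>x. finite (S \<inter> {..x})"
  shows "\<exists>!l :: nat \<Rightarrow> real. strict_mono l \<and> range l = S"
proof -
  define c where "c x = card (S \<inter> {..x})" for x
  have c: "c x < c y" if "x \<in> S" "y \<in> S" "x < y" for x y
  proof -
    have "S \<inter> {..x} \<subseteq> S \<inter> {..y}" "y \<in> S \<inter> {..y}" "y \<notin> S \<inter> {..x}" using that by auto
    then show ?thesis unfolding c_def by (intro psubset_card_mono fin) blast
  qed
  have inj: "inj_on c S"
    by (rule inj_onI) (metis c less_irrefl linorder_less_linear)
  have infc: "infinite (c ` S)" using inf inj by (simp add: finite_image_iff)
  define l where "l n = inv_into S c (enumerate (c ` S) n)" for n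
  have e: "enumerate (c ` S) n \<in> c ` S" for n by (rule enumerate_in_set[OF infc])
  have lS: "l n \<in> S" and cl: "c (l n) = enumerate (c ` S) n" for n
    unfolding l_def using e[of n] by (simp_all add: inv_into_into f_inv_into_f)
  have "strict_mono l"
  proof (rule strict_monoI)
    fix m n :: nat assume "m < n"
    then have "c (l m) < c (l n)" unfolding cl using infc by (rule enumerate_mono)
    then show "l m < l n" using c[OF lS lS] by (metis less_asym less_irrefl linorder_less_linear)
  qed
  moreover have "range l = S"
  proof
    show "range l \<subseteq> S" using lS by auto
    show "S \<subseteq> range l"
    proof
      fix x assume x: "x \<in> S"
      then obtain n where "enumerate (c ` S) n = c x" using enumerate_Ex[of "c ` S" "c x"] infc
        by blast
      then have "l n = x" using inj x by (simp add: l_def)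
      then show "x \<in> range l" by auto
    qed
  qed
  ultimately show ?thesis by (blast intro: strict_mono_same_range_eq)
qed

lemma increasing_enum_Lambda_tilde:
  "strict_mono (increasing_enum Lambda_tilde)" "range (increasing_enum Lambda_tilde) = Lambda_tilde"
proof -
  have fin: "finite (Lambda_tilde \<inter> {..x})" for x
  proof (rule finite_subset)
    define N where "N = nat \<lceil>x\<rceil>"
    show "Lambda_tilde \<inter> {..x} \<subseteq> (\<lambda>(k, j). real j / 2 ^ k) ` ({..N} \<times> {..N * 2 ^ N})"
    proof
      fix y assume "y \<in> Lambda_tilde \<inter> {..x}"
      then obtain k j where y: "y = real j / 2 ^ k" "real k \<le> y" "y \<le> x"
        by (auto simp: Lambda_tilde_def dyadic_grid_def)
      have xN: "x \<le> real N" unfolding N_def by linarith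
      have k: "k \<le> N" using y xN by linarith
      have "real j = y * 2 ^ k" using y by simp
      also have "\<dots> \<le> real N * 2 ^ N"
        using y xN k by (intro mult_mono power_increasing) auto
      finally have "real j \<le> real (N * 2 ^ N)" by simp
      then have "j \<le> N * 2 ^ N" by (rule of_nat_le_iff[THEN iffD1])
      then show "y \<in> (\<lambda>(k, j). real j / 2 ^ k) ` ({..N} \<times> {..N * 2 ^ N})"
        using k y by force
    qed
  qed simp
  have "real n \<in> Lambda_tilde" if "n \<ge> 1" for n
    using that unfolding Lambda_tilde_def dyadic_grid_def
    by (auto intro!: bexI[of _ n] exI[of _ "n * 2 ^ n"])
  then have "real ` {1..} \<subseteq> Lambda_tilde" by auto
  moreover have "infinite (real ` {1..})"
    by (simp add: finite_image_iff infinite_Ici)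
  ultimately have "infinite Lambda_tilde" using finite_subset by blast
  from theI'[OF increasing_enum_unique[OF this fin]]
  show "strict_mono (increasing_enum Lambda_tilde)"
    "range (increasing_enum Lambda_tilde) = Lambda_tilde"
    by (simp_all add: increasing_enum_def)
qed

end

theory Submission
  imports Defs
begin

text \<open>Write \<open>\<Lambda>\<close> for the random set and \<open>s x = \<Sum>l\<in>\<Lambda>. f (x + l)\<close>. Almost surely \<open>\<Lambda>\<close> contains, for
  some \<open>c > 0\<close> and every \<open>m\<close>, at least \<open>c * 2 ^ (k - m)\<close> points of each dyadic interval of
  length \<open>1 / 2 ^ m\<close> in \<open>[k, k + 1)\<close>, once \<open>k\<close> is large (Chernoff and Borel--Cantelli). This is all that is
  used about \<open>\<Lambda>\<close>. If \<open>s\<close> is finite on a set of positive measure, then \<open>s\<close> is bounded on some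
  \<open>E\<close> of positive measure, and \<open>E\<close> nearly fills a dyadic interval \<open>I\<close>. A maximal inequality for
  the averages over \<open>x + \<int> / 2 ^ q\<close> shows that, outside a set of small measure, these cosets rarely
  hit \<open>I - E\<close>. For such \<open>x\<close> and \<open>y = x + l\<close> with \<open>l \<in> \<Lambda>\<close> large, a fixed proportion of the possible
  points of \<open>\<Lambda>\<close> therefore lies in \<open>y - E\<close>. Integrating \<open>f\<close> against the number of points of \<open>\<Lambda>\<close> in
  \<open>y - E\<close> gives \<open>\<integral>\<^sub>E s < \<infinity>\<close>, so the integral of the tail of \<open>s\<close> over these \<open>x\<close> is finite
  too. Hence \<open>s\<close> is finite almost everywhere.\<close>

subsection \<open>Sums over countable sets and translates\<close>

lemma borel_measurable_nn_integral_count_space: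
  fixes f :: "'i \<Rightarrow> 'a \<Rightarrow> ennreal"
  assumes I: "countable I" and f[measurable]: "\<And>i. i \<in> I \<Longrightarrow> f i \<in> borel_measurable M"
  shows "(\<lambda>x. \<integral>\<^sup>+i. f i x \<partial>count_space I) \<in> borel_measurable M"
proof cases
  assume "finite I" then show ?thesis
    by (simp add: nn_integral_count_space_finite)
next
  assume inf: "infinite I"
  then have [simp]: "I \<noteq> {}" by auto
  note * = bij_betw_from_nat_into[OF I inf]
  have "(\<integral>\<^sup>+i. f i x \<partial>count_space I) = (\<Sum>n. f (from_nat_into I n) x)" for x
    by (simp add: nn_integral_bij_count_space[symmetric, OF *] nn_integral_count_space_nat)
  then show ?thesis by (simp add: from_nat_into)
qed

text \<open>\<open>conv_set\<close> is stated with an unordered sum; as an integral over counting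
  measure it becomes accessible to Tonelli.\<close>

lemma infsum_eq_nn_integral_count_space:
  fixes f :: "'a \<Rightarrow> ennreal"
  assumes I: "countable I"
  shows "(\<Sum>\<^sub>\<infinity>i\<in>I. f i) = (\<integral>\<^sup>+i. f i \<partial>count_space I)"
proof cases
  assume "finite I" then show ?thesis
    by (simp add: nn_integral_count_space_finite)
next
  assume inf: "infinite I"
  note * = bij_betw_from_nat_into[OF I inf]
  have "((\<lambda>n. f (from_nat_into I n)) has_sum (\<Sum>\<^sub>\<infinity>i\<in>I. f i)) UNIV"
    using has_sum_infsum[OF nonneg_summable_on_complete, of UNIV "\<lambda>n. f (from_nat_into I n)"]
    by (simp add: infsum_reindex_bij_betw[OF *])
  then have "(\<Sum>\<^sub>\<infinity>i\<in>I. f i) = (\<Sum>n. f (from_nat_into I n))"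
    by (blast dest: has_sum_imp_sums sums_unique)
  then show ?thesis
    by (simp add: nn_integral_bij_count_space[symmetric, OF *] nn_integral_count_space_nat)
qed

lemma nn_integral_lborel_translate:
  fixes h :: "real \<Rightarrow> ennreal"
  assumes [measurable]: "h \<in> borel_measurable borel"
  shows "(\<integral>\<^sup>+x. h (x + a) \<partial>lborel) = (\<integral>\<^sup>+x. h x \<partial>lborel)"
  using nn_integral_real_affine[of h 1 a] by (simp add: add.commute)

text \<open>Tonelli, followed by a translation by \<open>a i\<close> in each term. With
  \<open>G\<close> the indicator of a set, an integral of a sum of translates becomes an integral of
  \<open>F\<close> against a count of points; with \<open>G\<close> the indicator of a period, the
  line is folded onto that period.\<close>

lemma nn_integral_sum_translates:
  fixes F G :: "real \<Rightarrow> ennreal"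
  assumes I: "countable I" and [measurable]: "F \<in> borel_measurable borel" "G \<in> borel_measurable borel"
  shows "(\<integral>\<^sup>+x. G x * (\<integral>\<^sup>+i. F (x + a i) \<partial>count_space I) \<partial>lborel) =
    (\<integral>\<^sup>+x. F x * (\<integral>\<^sup>+i. G (x - a i) \<partial>count_space I) \<partial>lborel)"
proof -
  have "(\<integral>\<^sup>+x. G x * (\<integral>\<^sup>+i. F (x + a i) \<partial>count_space I) \<partial>lborel) =
      (\<integral>\<^sup>+x. \<integral>\<^sup>+i. G x * F (x + a i) \<partial>count_space I \<partial>lborel)"
    by (simp add: nn_integral_cmult)
  also have "\<dots> = (\<integral>\<^sup>+i. \<integral>\<^sup>+x. G x * F (x + a i) \<partial>lborel \<partial>count_space I)"
    by (intro nn_integral_count_space_nn_integral I) measurable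
  also have "\<dots> = (\<integral>\<^sup>+i. \<integral>\<^sup>+x. F x * G (x - a i) \<partial>lborel \<partial>count_space I)"
  proof (rule nn_integral_cong)
    fix i
    show "(\<integral>\<^sup>+x. G x * F (x + a i) \<partial>lborel) = (\<integral>\<^sup>+x. F x * G (x - a i) \<partial>lborel)"
      using nn_integral_lborel_translate[of "\<lambda>x. F x * G (x - a i)" "a i"] by (simp add: mult.commute)
  qed
  also have "\<dots> = (\<integral>\<^sup>+x. \<integral>\<^sup>+i. F x * G (x - a i) \<partial>count_space I \<partial>lborel)"
    by (intro nn_integral_count_space_nn_integral[symmetric] I) measurable
  also have "\<dots> = (\<integral>\<^sup>+x. F x * (\<integral>\<^sup>+i. G (x - a i) \<partial>count_space I) \<partial>lborel)"
    by (simp add: nn_integral_cmult)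
  finally show ?thesis .
qed

section \<open>Counting points of cosets of a dyadic grid\<close>

text \<open>Written as an integral over counting measure, the count may be infinite, is measurable
  in \<open>x\<close> and fits \<open>nn_integral_sum_translates\<close>.\<close>

definition hits :: "nat \<Rightarrow> real set \<Rightarrow> real \<Rightarrow> ennreal" where
  "hits q S x = (\<integral>\<^sup>+j. indicator S (x + of_int j / 2 ^ q) \<partial>count_space (UNIV :: int set))"

lemma hits_measurable [measurable]: "S \<in> sets borel \<Longrightarrow> hits q S \<in> borel_measurable borel"
  unfolding hits_def [abs_def] by (intro borel_measurable_nn_integral_count_space) auto

lemma hits_eq_emeasure: "hits q S x = emeasure (count_space UNIV) {j :: int. x + of_int j / 2 ^ q \<in> S}"
proof -
  have "hits q S x = (\<integral>\<^sup>+j. indicator {j :: int. x + of_int j / 2 ^ q \<in> S} j \<partial>count_space UNIV)"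
    unfolding hits_def by (intro nn_integral_cong) (auto split: split_indicator)
  then show ?thesis by simp
qed

lemma hits_shift: "hits q S (x + of_int i / 2 ^ q) = hits q S x"
proof -
  have "bij_betw (\<lambda>j. j + i) (UNIV :: int set) UNIV"
    by (rule bij_betwI[of _ _ _ "\<lambda>j. j - i"]) auto
  from nn_integral_bij_count_space[OF this, of "\<lambda>j. indicator S (x + of_int j / 2 ^ q)"]
  show ?thesis by (simp add: hits_def add_divide_distrib algebra_simps)
qed

text \<open>The grid of step \<open>1 / 2 ^ q\<close> lies inside the grid of step
  \<open>1 / 2 ^ q'\<close>, so the shift only permutes the points of each finer coset.\<close>

lemma hits_shift_coarse:
  assumes "q \<le> q'"
  shows "hits q' S (x + of_int i / 2 ^ q) = hits q' S x"
proof -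
  have "of_int i / 2 ^ q = (of_int (i * 2 ^ (q' - q)) / 2 ^ q' :: real)"
    using assms by (simp add: field_simps flip: power_add)
  then show ?thesis by (simp only: hits_shift)
qed

text \<open>Because the ends are integers and the interval is half-open, every coset hits it equally
  often, without rounding error. The window in the maximal inequality therefore has constant
  averages.\<close>

lemma hits_interval:
  fixes a b :: int
  assumes "a \<le> b"
  shows "hits q {real_of_int a..<real_of_int b} x = ennreal (real_of_int (b - a) * 2 ^ q)"
proof -
  let ?t = "(real_of_int a - x) * 2 ^ q"
  have "{j :: int. x + of_int j / 2 ^ q \<in> {real_of_int a..<real_of_int b}} =
    {\<lceil>?t\<rceil>..<\<lceil>?t + of_int ((b - a) * 2 ^ q)\<rceil>}"
  proof (intro set_eqI)
    fix j :: int
    have "real_of_int a \<le> x + of_int j / 2 ^ q \<longleftrightarrow> ?t \<le> of_int j"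
      by (simp add: field_simps)
    moreover have "x + of_int j / 2 ^ q < real_of_int b \<longleftrightarrow> of_int j < ?t + of_int ((b - a) * 2 ^ q)"
      by (simp add: field_simps)
    ultimately show "j \<in> {j. x + of_int j / 2 ^ q \<in> {real_of_int a..<real_of_int b}} \<longleftrightarrow>
        j \<in> {\<lceil>?t\<rceil>..<\<lceil>?t + of_int ((b - a) * 2 ^ q)\<rceil>}"
      by (simp add: ceiling_le_iff less_ceiling_iff)
  qed
  also have "\<dots> = {\<lceil>?t\<rceil>..<\<lceil>?t\<rceil> + (b - a) * 2 ^ q}"
    by (simp only: ceiling_add_of_int)
  finally have "hits q {real_of_int a..<real_of_int b} x = of_nat (nat ((b - a) * 2 ^ q))"
    by (simp add: hits_eq_emeasure)
  also have "\<dots> = ennreal (real (nat ((b - a) * 2 ^ q)))"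
    by (simp only: ennreal_of_nat_eq_real_of_nat)
  also have "real (nat ((b - a) * 2 ^ q)) = real_of_int (b - a) * 2 ^ q"
    using assms by simp
  finally show ?thesis .
qed

text \<open>Every real number lies in exactly one translate of \<open>{0..<1 / 2 ^ q}\<close> by a
  grid point, so the count produced by \<open>nn_integral_sum_translates\<close> is 1.\<close>

lemma nn_integral_eq_period:
  fixes h :: "real \<Rightarrow> ennreal"
  assumes [measurable]: "h \<in> borel_measurable borel"
  shows "(\<integral>\<^sup>+x. h x \<partial>lborel) =
    (\<integral>\<^sup>+x. indicator {0..<1 / 2 ^ q} x * (\<integral>\<^sup>+j. h (x + of_int j / 2 ^ q) \<partial>count_space (UNIV :: int set)) \<partial>lborel)"
proof -
  have one: "(\<integral>\<^sup>+j. indicator {0..<1 / 2 ^ q} (x - of_int j / 2 ^ q) \<partial>count_space (UNIV :: int set)) = (1 :: ennreal)"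
    for x :: real
  proof -
    have "indicator {0..<1 / 2 ^ q} (x - of_int j / 2 ^ q) = (indicator {\<lfloor>x * 2 ^ q\<rfloor>} j :: ennreal)" for j :: int
    proof -
      have "(0 \<le> x - of_int j / 2 ^ q \<and> x - of_int j / 2 ^ q < 1 / 2 ^ q) \<longleftrightarrow> \<lfloor>x * 2 ^ q\<rfloor> = j"
        by (simp add: floor_eq_iff pos_le_divide_eq pos_divide_le_eq less_diff_eq diff_less_eq
            pos_less_divide_eq flip: add_divide_distrib) (simp add: field_simps)
      then show ?thesis by (auto split: split_indicator)
    qed
    then show ?thesis by simp
  qed
  show ?thesis
    by (subst nn_integral_sum_translates) (simp_all add: one)
qed

subsection \<open>The maximal inequality and dyadic density\<close>

text \<open>A reverse martingale argument: decompose by the last \<open>q \<le> Q\<close> at which the average exceeds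
  \<open>d\<close>. The set \<open>T Q q\<close> where this happens is invariant under translation by \<open>1 / 2 ^ q\<close>, since only
  averages over finer cosets enter its definition, so integrals over it fold to one period.\<close>

lemma emeasure_hits_maximal:
  fixes S :: "real set" and d :: real and R :: nat
  assumes S[measurable]: "S \<in> sets borel" and d: "d > 0"
  shows "ennreal d * emeasure lborel ({x. \<exists>q. hits q S x > ennreal (d * 2 ^ q)} \<inter> {-real R..<real R})
    \<le> ennreal (2 * real R) * emeasure lborel S"
proof -
  define W where "W = {-real R..<real R}"
  have [measurable]: "W \<in> sets borel" by (simp add: W_def)
  have hits_W: "hits q W x = ennreal (2 * real R * 2 ^ q)" for q x
    using hits_interval[of "- int R" "int R" q x] by (simp add: W_def)
  define A where "A q = {x. hits q S x > ennreal (d * 2 ^ q)}" for q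
  have [measurable]: "A q \<in> sets borel" for q unfolding A_def by measurable
  define T where "T Q q = A q - (\<Union>q'\<in>{q<..Q}. A q')" for Q q
  have [measurable]: "T Q q \<in> sets borel" for Q q unfolding T_def by measurable
  have A_shift: "x + of_int j / 2 ^ q \<in> A q' \<longleftrightarrow> x \<in> A q'" if "q \<le> q'" for x j q q'
    using hits_shift_coarse[OF that] by (simp add: A_def)
  have T_shift: "x + of_int j / 2 ^ q \<in> T Q q \<longleftrightarrow> x \<in> T Q q" for x j q Q
    using A_shift[of q] by (auto simp: T_def)
  have fold: "emeasure lborel (B \<inter> T Q q) =
      (\<integral>\<^sup>+x. indicator {0..<1 / 2 ^ q} x * (indicator (T Q q) x * hits q B x) \<partial>lborel)"
    if [measurable]: "B \<in> sets borel" for B q Q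
  proof -
    have "(\<integral>\<^sup>+j. indicator (B \<inter> T Q q) (x + of_int j / 2 ^ q) \<partial>count_space (UNIV :: int set)) =
        indicator (T Q q) x * hits q B x" for x :: real
    proof -
      have "indicator (B \<inter> T Q q) (x + of_int j / 2 ^ q) =
          (indicator (T Q q) x * indicator B (x + of_int j / 2 ^ q) :: ennreal)" for j :: int
        using T_shift[of x j q Q] by (auto split: split_indicator)
      then show ?thesis by (simp add: hits_def nn_integral_cmult)
    qed
    then show ?thesis
      using nn_integral_eq_period[of "indicator (B \<inter> T Q q)" q] by simp
  qed
  \<comment> \<open>Compare the two folded integrals pointwise: on \<open>T Q q\<close> the window
    is hit exactly \<open>2 * R * 2 ^ q\<close> times, and \<open>S\<close> more than
    \<open>d * 2 ^ q\<close> times.\<close>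
  have one: "ennreal d * emeasure lborel (W \<inter> T Q q) \<le> ennreal (2 * real R) * emeasure lborel (S \<inter> T Q q)"
    for q Q
  proof -
    have "ennreal d * emeasure lborel (W \<inter> T Q q) =
        (\<integral>\<^sup>+x. ennreal d * (indicator {0..<1 / 2 ^ q} x * (indicator (T Q q) x * hits q W x)) \<partial>lborel)"
      by (simp add: fold nn_integral_cmult)
    also have "\<dots> \<le> (\<integral>\<^sup>+x. ennreal (2 * real R) *
        (indicator {0..<1 / 2 ^ q} x * (indicator (T Q q) x * hits q S x)) \<partial>lborel)"
    proof (rule nn_integral_mono)
      fix x
      have "ennreal d * ennreal (2 * real R * 2 ^ q) = ennreal (2 * real R) * ennreal (d * 2 ^ q)"
        using d by (simp add: ac_simps flip: ennreal_mult)
      also have "\<dots> \<le> ennreal (2 * real R) * hits q S x" if "x \<in> T Q q"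
        using that by (intro mult_left_mono) (auto simp: T_def A_def)
      finally show "ennreal d * (indicator {0..<1 / 2 ^ q} x * (indicator (T Q q) x * hits q W x)) \<le>
          ennreal (2 * real R) * (indicator {0..<1 / 2 ^ q} x * (indicator (T Q q) x * hits q S x))"
        by (auto simp: hits_W split: split_indicator)
    qed
    also have "\<dots> = ennreal (2 * real R) * emeasure lborel (S \<inter> T Q q)"
      by (simp add: fold nn_integral_cmult)
    finally show ?thesis .
  qed
  have disj: "disjoint_family_on (T Q) {..Q}" for Q
    unfolding disjoint_family_on_def T_def by (auto simp: set_eq_iff) (metis greaterThanAtMost_iff linorder_neqE_nat)
  have fin: "ennreal d * emeasure lborel (W \<inter> (\<Union>q\<le>Q. A q)) \<le> ennreal (2 * real R) * emeasure lborel S" for Q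
  proof -
    have "x \<in> (\<Union>q\<le>Q. T Q q)" if x: "x \<in> (\<Union>q\<le>Q. A q)" for x
    proof -
      define m where "m = Max {q. q \<le> Q \<and> x \<in> A q}"
      have f: "finite {q. q \<le> Q \<and> x \<in> A q}" "{q. q \<le> Q \<and> x \<in> A q} \<noteq> {}"
        using x by auto
      have "m \<le> Q" "x \<in> A m" using Max_in[OF f] by (auto simp: m_def)
      moreover have "q \<le> m" if "x \<in> A q" "q \<le> Q" for q
        unfolding m_def using that by (intro Max_ge f) auto
      ultimately show ?thesis by (force simp: T_def)
    qed
    then have "emeasure lborel (W \<inter> (\<Union>q\<le>Q. A q)) \<le> emeasure lborel (\<Union>q\<le>Q. W \<inter> T Q q)"
      by (intro emeasure_mono) auto
    also have "\<dots> = (\<Sum>q\<le>Q. emeasure lborel (W \<inter> T Q q))"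
      using disj[of Q] by (intro sum_emeasure[symmetric]) (auto simp: disjoint_family_on_def)
    finally have "ennreal d * emeasure lborel (W \<inter> (\<Union>q\<le>Q. A q)) \<le>
        ennreal d * (\<Sum>q\<le>Q. emeasure lborel (W \<inter> T Q q))"
      by (rule mult_left_mono) simp
    also have "\<dots> \<le> (\<Sum>q\<le>Q. ennreal (2 * real R) * emeasure lborel (S \<inter> T Q q))"
      unfolding sum_distrib_left by (intro sum_mono one)
    also have "\<dots> = ennreal (2 * real R) * emeasure lborel (\<Union>q\<le>Q. S \<inter> T Q q)"
      unfolding sum_distrib_left[symmetric]
      using disj[of Q] by (subst sum_emeasure) (auto simp: disjoint_family_on_def)
    also have "\<dots> \<le> ennreal (2 * real R) * emeasure lborel S"
      by (intro mult_left_mono emeasure_mono) auto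
    finally show ?thesis .
  qed
  \<comment> \<open>The bound for a last exceedance among the levels up to \<open>Q\<close> does not
    depend on \<open>Q\<close>, so continuity from below removes the truncation.\<close>
  have inc: "incseq (\<lambda>Q. W \<inter> (\<Union>q\<le>Q. A q))"
    by (intro monoI Int_mono UN_mono) auto
  have "(SUP Q. emeasure lborel (W \<inter> (\<Union>q\<le>Q. A q))) = emeasure lborel (\<Union>Q. W \<inter> (\<Union>q\<le>Q. A q))"
    using inc by (intro SUP_emeasure_incseq) auto
  also have "(\<Union>Q. W \<inter> (\<Union>q\<le>Q. A q)) = {x. \<exists>q. hits q S x > ennreal (d * 2 ^ q)} \<inter> W"
    by (auto simp: A_def)
  finally have "ennreal d * emeasure lborel ({x. \<exists>q. hits q S x > ennreal (d * 2 ^ q)} \<inter> W) =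
      (SUP Q. ennreal d * emeasure lborel (W \<inter> (\<Union>q\<le>Q. A q)))"
    by (simp add: SUP_mult_left_ennreal[symmetric])
  also have "\<dots> \<le> ennreal (2 * real R) * emeasure lborel S"
    by (intro SUP_least fin)
  finally show ?thesis unfolding W_def .
qed

section \<open>Dyadic intervals and density\<close>

definition dyadic_ivl :: "nat \<Rightarrow> int \<Rightarrow> real set" where
  "dyadic_ivl m i = {of_int i / 2 ^ m..<(of_int i + 1) / 2 ^ m}"

lemma dyadic_ivl_measurable [measurable]: "dyadic_ivl m i \<in> sets borel"
  by (simp add: dyadic_ivl_def)

text \<open>In terms of floors, disjointness within a level is immediate and nesting of consecutive
  levels becomes halving of floors.\<close>

lemma mem_dyadic_ivl_iff: "x \<in> dyadic_ivl m i \<longleftrightarrow> i = \<lfloor>x * 2 ^ m\<rfloor>"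
  unfolding dyadic_ivl_def atLeastLessThan_iff
  by (simp only: pos_divide_le_eq pos_less_divide_eq zero_less_power zero_less_numeral)
     (auto simp: floor_eq_iff eq_commute[of i])

lemma emeasure_dyadic_ivl: "emeasure lborel (dyadic_ivl m i) = ennreal (1 / 2 ^ m)"
  by (simp add: dyadic_ivl_def divide_right_mono diff_divide_distrib[symmetric])

lemma disjoint_dyadic_ivl: "disjoint_family_on (dyadic_ivl m) J"
  by (auto simp: disjoint_family_on_def mem_dyadic_ivl_iff)

text \<open>If every dyadic interval missed too much of \<open>E\<close>, then summing over the intervals of level
  \<open>m\<close> inside an open \<open>U \<supseteq> E\<close> and letting \<open>m\<close> grow would make \<open>U - E\<close> too large.\<close>

lemma dyadic_density:
  fixes E :: "real set" and e :: real
  assumes E[measurable]: "E \<in> sets borel" and pos: "0 < emeasure lborel E"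
    and fin: "emeasure lborel E < \<infinity>" and e: "e > 0"
  obtains m i where "E \<inter> dyadic_ivl m i \<noteq> {}" "emeasure lborel (dyadic_ivl m i - E) \<le> ennreal (e / 2 ^ m)"
proof (rule ccontr)
  assume "\<not> thesis"
  with that have *: "\<not> emeasure lborel (dyadic_ivl m i - E) \<le> ennreal (e / 2 ^ m)"
    if "E \<inter> dyadic_ivl m i \<noteq> {}" for m i
    using that by blast
  have neg: "ennreal (e / 2 ^ m) < emeasure lborel (dyadic_ivl m i - E)"
    if "E \<inter> dyadic_ivl m i \<noteq> {}" for m i
    using *[OF that] by (simp add: not_le)
  have step: "ennreal e * emeasure lborel (dyadic_ivl m i \<inter> E) \<le> emeasure lborel (dyadic_ivl m i - E)" for m i
  proof (cases "E \<inter> dyadic_ivl m i = {}")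
    case True
    then show ?thesis by (simp add: Int_commute)
  next
    case False
    have "ennreal e * emeasure lborel (dyadic_ivl m i \<inter> E) \<le> ennreal e * ennreal (1 / 2 ^ m)"
      unfolding emeasure_dyadic_ivl[of m i, symmetric] by (intro mult_left_mono emeasure_mono) auto
    also have "\<dots> = ennreal (e / 2 ^ m)" using e by (simp flip: ennreal_mult)
    finally show ?thesis using neg[OF False] by simp
  qed
  obtain r where r: "emeasure lborel E = ennreal r" "r > 0"
    using pos fin by (cases "emeasure lborel E") auto
  \<comment> \<open>The excess of \<open>U\<close> over \<open>E\<close> is below \<open>e\<close>
    times the measure of \<open>E\<close>, while summing \<open>step\<close> over the dyadic
    intervals inside \<open>U\<close> will force it to be at least that large.\<close>
  obtain U where U: "open U" "E \<subseteq> U" "emeasure lborel (U - E) < ennreal (e * r)"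
    using outer_regular_lborel[OF E, of "e * r"] e r by auto
  have [measurable]: "U \<in> sets borel" using U by simp
  define J where "J m = {i. dyadic_ivl m i \<subseteq> U}" for m
  define V where "V m = (\<Union>i\<in>J m. dyadic_ivl m i)" for m
  have [measurable]: "V m \<in> sets borel" for m unfolding V_def by measurable
  \<comment> \<open>An interval of level \<open>m\<close> inside \<open>U\<close> splits into
    intervals of level \<open>Suc m\<close>, which are again inside \<open>U\<close>.\<close>
  have "incseq V"
  proof (rule incseq_SucI, rule subsetI)
    fix m x assume "x \<in> V m"
    then have sub: "dyadic_ivl m \<lfloor>x * 2 ^ m\<rfloor> \<subseteq> U" by (auto simp: V_def J_def mem_dyadic_ivl_iff)
    have "dyadic_ivl (Suc m) \<lfloor>x * 2 ^ Suc m\<rfloor> \<subseteq> dyadic_ivl m \<lfloor>x * 2 ^ m\<rfloor>"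
    proof
      fix y assume "y \<in> dyadic_ivl (Suc m) \<lfloor>x * 2 ^ Suc m\<rfloor>"
      then have *: "\<lfloor>y * 2 ^ m * 2\<rfloor> = \<lfloor>x * 2 ^ m * 2\<rfloor>" by (simp add: mem_dyadic_ivl_iff ac_simps)
      have "\<lfloor>z\<rfloor> = \<lfloor>z * 2\<rfloor> div 2" for z :: real
        using floor_divide_real_eq_div[of 2 "z * 2"] by simp
      then have "\<lfloor>y * 2 ^ m\<rfloor> = \<lfloor>x * 2 ^ m\<rfloor>" using * by metis
      then show "y \<in> dyadic_ivl m \<lfloor>x * 2 ^ m\<rfloor>" by (simp add: mem_dyadic_ivl_iff)
    qed
    with sub show "x \<in> V (Suc m)" by (auto simp: V_def J_def mem_dyadic_ivl_iff)
  qed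
  have UV: "(\<Union>m. V m) = U"
  proof
    show "(\<Union>m. V m) \<subseteq> U" by (auto simp: V_def J_def)
    show "U \<subseteq> (\<Union>m. V m)"
    proof
      fix x assume "x \<in> U"
      then obtain s where s: "s > 0" "ball x s \<subseteq> U" using U(1) open_contains_ball by blast
      obtain m where m: "(1 / 2) ^ m < s" using real_arch_pow_inv[of s "1/2"] s by auto
      have "dyadic_ivl m \<lfloor>x * 2 ^ m\<rfloor> \<subseteq> ball x s"
      proof
        fix y assume y: "y \<in> dyadic_ivl m \<lfloor>x * 2 ^ m\<rfloor>"
        have "x \<in> dyadic_ivl m \<lfloor>x * 2 ^ m\<rfloor>" by (simp add: mem_dyadic_ivl_iff)
        with y have "\<bar>x - y\<bar> < 1 / 2 ^ m"
          by (auto simp: dyadic_ivl_def add_divide_distrib)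
        with m show "y \<in> ball x s" by (simp add: dist_real_def power_one_over)
      qed
      with s have "x \<in> V m" by (auto simp: V_def J_def mem_dyadic_ivl_iff)
      then show "x \<in> (\<Union>m. V m)" by blast
    qed
  qed
  have Vm: "ennreal e * emeasure lborel (V m \<inter> E) \<le> emeasure lborel (U - E)" for m
  proof -
    have d: "disjoint_family_on (\<lambda>i. dyadic_ivl m i \<inter> E) (J m)" "disjoint_family_on (\<lambda>i. dyadic_ivl m i - E) (J m)"
      using disjoint_dyadic_ivl[of m "J m"] by (auto simp: disjoint_family_on_def)
    have "emeasure lborel (V m \<inter> E) = (\<integral>\<^sup>+i. emeasure lborel (dyadic_ivl m i \<inter> E) \<partial>count_space (J m))"
      using emeasure_UN_countable[OF _ _ d(1), of lborel] by (simp add: V_def)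
    then have "ennreal e * emeasure lborel (V m \<inter> E) =
        (\<integral>\<^sup>+i. ennreal e * emeasure lborel (dyadic_ivl m i \<inter> E) \<partial>count_space (J m))"
      by (simp add: nn_integral_cmult)
    also have "\<dots> \<le> (\<integral>\<^sup>+i. emeasure lborel (dyadic_ivl m i - E) \<partial>count_space (J m))"
      by (intro nn_integral_mono step)
    also have "\<dots> = emeasure lborel (\<Union>i\<in>J m. dyadic_ivl m i - E)"
      using emeasure_UN_countable[OF _ _ d(2), of lborel] by simp
    also have "\<dots> \<le> emeasure lborel (U - E)"
      by (intro emeasure_mono) (auto simp: J_def)
    finally show ?thesis .
  qed
  have "(SUP m. emeasure lborel (V m \<inter> E)) = emeasure lborel (\<Union>m. V m \<inter> E)"
    using \<open>incseq V\<close> by (intro SUP_emeasure_incseq) (auto simp: incseq_def)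
  also have "(\<Union>m. V m \<inter> E) = E" using UV U(2) by blast
  finally have "ennreal e * emeasure lborel E = (SUP m. ennreal e * emeasure lborel (V m \<inter> E))"
    by (simp add: SUP_mult_left_ennreal[symmetric])
  also have "\<dots> \<le> emeasure lborel (U - E)" by (intro SUP_least Vm)
  also have "\<dots> < ennreal e * emeasure lborel E" using U(3) r e by (simp add: ennreal_mult)
  finally show False by simp
qed

subsection \<open>Density of the random set\<close>

lemma prob_space_selection_measure: "prob_space (selection_measure p)"
  unfolding selection_measure_def by (intro prob_space_PiM measure_pmf.prob_space_axioms)

lemma space_selection_measure [simp]: "space (selection_measure p) = UNIV"
  by (simp add: selection_measure_def space_PiM)

lemma measurable_selection_component [measurable]:
  "(\<lambda>\<omega>. \<omega> n) \<in> selection_measure p \<rightarrow>\<^sub>M count_space UNIV"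
proof -
  have "(\<lambda>\<omega>. \<omega> n) \<in> selection_measure p \<rightarrow>\<^sub>M measure_pmf (bernoulli_pmf p)"
    unfolding selection_measure_def by (rule measurable_component_singleton) simp
  then show ?thesis by simp
qed

text \<open>The integrand depends only on the coordinates in \<open>A\<close>, so the infinite
  product can be restricted to the finite one, where independence factors the integral.\<close>

lemma nn_integral_selection_measure_prod:
  fixes g :: "bool \<Rightarrow> ennreal"
  assumes A: "finite A"
  shows "(\<integral>\<^sup>+\<omega>. (\<Prod>n\<in>A. g (\<omega> n)) \<partial>selection_measure p) = (\<integral>\<^sup>+b. g b \<partial>bernoulli_pmf p) ^ card A"
proof -
  let ?B = "\<lambda>_ :: nat. measure_pmf (bernoulli_pmf p)"
  interpret product_prob_space ?B UNIV
    by standard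
  have [measurable]: "g \<in> borel_measurable (count_space UNIV)" by simp
  have m: "(\<lambda>\<omega>. \<Prod>n\<in>A. g (\<omega> n)) \<in> borel_measurable (PiM A ?B)"
    by (intro borel_measurable_prod_ennreal measurable_compose[OF measurable_component_singleton]) auto
  have "(\<integral>\<^sup>+b. g b \<partial>bernoulli_pmf p) ^ card A = (\<integral>\<^sup>+\<omega>. (\<Prod>n\<in>A. g (\<omega> n)) \<partial>PiM A ?B)"
    using A by (subst product_nn_integral_prod) auto
  also have "\<dots> = (\<integral>\<^sup>+\<omega>. (\<Prod>n\<in>A. g (\<omega> n)) \<partial>distr (PiM UNIV ?B) (PiM A ?B) (\<lambda>\<omega>. restrict \<omega> A))"
    using A by (subst distr_PiM_restrict_finite) auto
  also have "\<dots> = (\<integral>\<^sup>+\<omega>. (\<Prod>n\<in>A. g (\<omega> n)) \<partial>PiM UNIV ?B)"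
    using m by (subst nn_integral_distr) (auto intro!: nn_integral_cong prod.cong measurable_restrict_subset)
  finally show ?thesis by (simp add: selection_measure_def)
qed

text \<open>Chernoff's bound. A single coordinate contributes the factor
  \<open>exp (- 2 * c)\<close> to the expectation of \<open>exp (- count)\<close>; Markov's
  inequality at the threshold \<open>c * card A\<close> costs \<open>exp (c * card A)\<close>, and
  \<open>exp (- c * card A)\<close> remains.\<close>

lemma selection_lower_tail:
  assumes p: "0 < p" "p < 1" and A: "finite A"
    and c: "exp (- 2 * c) = 1 - p * (1 - exp (- 1))"
  shows "measure (selection_measure p) {\<omega>. real (card {n \<in> A. \<omega> n}) < c * real (card A)} \<le> exp (- c * real (card A))"
proof -
  interpret prob_space "selection_measure p" by (rule prob_space_selection_measure)
  define g where "g b = ennreal (exp (- of_bool b))" for b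
  have [measurable]: "Measurable.pred (selection_measure p) (\<lambda>\<omega>. real (card {n \<in> A. \<omega> n}) < c * real (card A))"
  proof -
    have "card {n \<in> A. \<omega> n} = (\<Sum>n\<in>A. if \<omega> n then 1 else 0)" for \<omega>
      using A by (simp add: sum.If_cases Int_def)
    then show ?thesis by simp
  qed
  let ?X = "{\<omega>. real (card {n \<in> A. \<omega> n}) < c * real (card A)}"
  have [measurable]: "?X \<in> sets (selection_measure p)"
    using predE[OF \<open>Measurable.pred (selection_measure p) _\<close>] by simp
  have prod: "(\<Prod>n\<in>A. g (\<omega> n)) = ennreal (exp (- real (card {n \<in> A. \<omega> n})))" for \<omega>
  proof -
    have "(\<Prod>n\<in>A. g (\<omega> n)) = ennreal (exp (\<Sum>n\<in>A. - of_bool (\<omega> n)))"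
      using A by (simp add: g_def prod_ennreal exp_sum)
    also have "(\<Sum>n\<in>A. - of_bool (\<omega> n)) = - real (card {n \<in> A. \<omega> n})"
      using A by (simp add: sum_negf Int_def)
    finally show ?thesis .
  qed
  have "(\<integral>\<^sup>+b. g b \<partial>bernoulli_pmf p) = ennreal (exp (- 1) * p + (1 - p))"
    using p by (simp add: g_def nn_integral_measure_pmf_finite UNIV_bool mult.commute add.commute
        flip: ennreal_mult ennreal_plus)
  also have "exp (- 1) * p + (1 - p) = exp (- 2 * c)"
    unfolding c by (simp add: algebra_simps)
  finally have "(\<integral>\<^sup>+b. g b \<partial>bernoulli_pmf p) = ennreal (exp (- 2 * c))" .
  then have int: "(\<integral>\<^sup>+\<omega>. (\<Prod>n\<in>A. g (\<omega> n)) \<partial>selection_measure p) = ennreal (exp (- 2 * c * real (card A)))"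
    using nn_integral_selection_measure_prod[OF A, of p g]
    by (simp add: ennreal_power mult.commute flip: exp_of_nat_mult)
  have [measurable]: "g \<in> borel_measurable (count_space UNIV)" by simp
  have "emeasure (selection_measure p) ?X = (\<integral>\<^sup>+\<omega>. indicator ?X \<omega> \<partial>selection_measure p)"
    by simp
  also have "\<dots> \<le> (\<integral>\<^sup>+\<omega>. ennreal (exp (c * real (card A))) * (\<Prod>n\<in>A. g (\<omega> n)) \<partial>selection_measure p)"
  proof (rule nn_integral_mono)
    fix \<omega>
    have "1 \<le> ennreal (exp (c * real (card A))) * (\<Prod>n\<in>A. g (\<omega> n))" if "\<omega> \<in> ?X"
    proof -
      have "1 \<le> exp (c * real (card A) + - real (card {n \<in> A. \<omega> n}))" using that by simp
      then show ?thesis unfolding prod exp_add by (simp flip: ennreal_mult)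
    qed
    then show "indicator ?X \<omega> \<le> ennreal (exp (c * real (card A))) * (\<Prod>n\<in>A. g (\<omega> n))"
      by (auto split: split_indicator)
  qed
  also have "\<dots> = ennreal (exp (c * real (card A))) * ennreal (exp (- 2 * c * real (card A)))"
    by (subst nn_integral_cmult) (simp_all add: int borel_measurable_prod_ennreal measurable_compose[OF measurable_selection_component])
  also have "\<dots> = ennreal (exp (- c * real (card A)))"
    by (simp flip: ennreal_mult exp_add)
  finally show ?thesis by (simp add: emeasure_eq_measure)
qed

text \<open>A point below \<open>q + 1\<close> comes from a level \<open>k \<le> q\<close>, and the
  grids are nested.\<close>

lemma Lambda_tilde_scaled_int:
  assumes x: "x \<in> Lambda_tilde" "x < real q + 1"
  obtains j :: int where "x = of_int j / 2 ^ q"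
proof -
  obtain k j where kj: "k \<ge> 1" "x = real j / 2 ^ k" "real k \<le> x" 
    using x by (auto simp: Lambda_tilde_def dyadic_grid_def)
  then have "k \<le> q" using x by linarith
  then have "(2 :: real) ^ q = 2 ^ k * 2 ^ (q - k)" by (simp flip: power_add)
  then have "x = of_int (int j * 2 ^ (q - k)) / 2 ^ q"
    using kj by simp
  then show thesis by (rule that)
qed

text \<open>The bounds on \<open>i\<close> place the interval inside \<open>[k, k + 1)\<close>,
  where \<open>Lambda_tilde\<close> is exactly the grid of step \<open>1 / 2 ^ k\<close>.\<close>

lemma card_Lambda_tilde_dyadic_ivl:
  fixes i :: int
  assumes mk: "m \<le> k" "1 \<le> k" and i: "int k * 2 ^ m \<le> i" "i < (int k + 1) * 2 ^ m"
  shows "finite (Lambda_tilde \<inter> dyadic_ivl m i)" "card (Lambda_tilde \<inter> dyadic_ivl m i) = 2 ^ (k - m)"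
proof -
  let ?J = "{i * 2 ^ (k - m)..<(i + 1) * 2 ^ (k - m)}"
  have inj: "inj (\<lambda>j :: int. of_int j / 2 ^ k :: real)" by (rule injI) simp
  have sub: "real k \<le> x \<and> x < real k + 1" if "x \<in> dyadic_ivl m i" for x
  proof -
    have "real k * 2 ^ m \<le> of_int i"
    proof -
      have "real_of_int (int k * 2 ^ m) \<le> real_of_int i" using i(1) by (simp only: of_int_le_iff)
      then show ?thesis by simp
    qed
    moreover have "of_int i + 1 \<le> (real k + 1) * 2 ^ m"
    proof -
      have "real_of_int (i + 1) \<le> real_of_int ((int k + 1) * 2 ^ m)" using i(2) by (simp only: of_int_le_iff)
      then show ?thesis by simp
    qed
    ultimately have "real k \<le> of_int i / 2 ^ m" "(of_int i + 1) / 2 ^ m \<le> real k + 1"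
      by (simp_all add: pos_le_divide_eq pos_divide_le_eq)
    then show ?thesis using that by (simp add: dyadic_ivl_def)
  qed
  have memJ: "of_int j / 2 ^ k \<in> dyadic_ivl m i \<longleftrightarrow> j \<in> ?J" for j :: int
  proof -
    have k: "(2 :: real) ^ k = 2 ^ m * 2 ^ (k - m)" using mk by (simp flip: power_add)
    have "of_int j / 2 ^ k * 2 ^ m = (of_int j / 2 ^ (k - m) :: real)" by (simp add: k)
    then have "of_int j / 2 ^ k \<in> dyadic_ivl m i \<longleftrightarrow>
        of_int i \<le> of_int j / (2 ^ (k - m) :: real) \<and> of_int j / (2 ^ (k - m) :: real) < of_int i + 1"
      by (simp only: mem_dyadic_ivl_iff floor_eq_iff eq_commute[of i])
    also have "\<dots> \<longleftrightarrow>
        of_int (i * 2 ^ (k - m)) \<le> real_of_int j \<and> real_of_int j < of_int ((i + 1) * 2 ^ (k - m))"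
      by (simp add: pos_le_divide_eq pos_divide_less_eq)
    finally have "of_int j / 2 ^ k \<in> dyadic_ivl m i \<longleftrightarrow>
        of_int (i * 2 ^ (k - m)) \<le> real_of_int j \<and> real_of_int j < of_int ((i + 1) * 2 ^ (k - m))" .
    then show ?thesis unfolding of_int_le_iff of_int_less_iff by simp
  qed
  have "Lambda_tilde \<inter> dyadic_ivl m i = (\<lambda>j. of_int j / 2 ^ k) ` ?J"
  proof (intro equalityI subsetI)
    fix x assume x: "x \<in> Lambda_tilde \<inter> dyadic_ivl m i"
    then obtain j :: int where "x = of_int j / 2 ^ k"
      using Lambda_tilde_scaled_int[of x k] sub[of x] by blast
    then show "x \<in> (\<lambda>j. of_int j / 2 ^ k) ` ?J" using x memJ by blast
  next
    fix x assume "x \<in> (\<lambda>j. of_int j / 2 ^ k :: real) ` ?J"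
    then obtain j where j: "x = of_int j / 2 ^ k" "j \<in> ?J" by blast
    then have x: "x \<in> dyadic_ivl m i" using memJ by blast
    have "0 < x" using sub[OF x] mk by linarith
    then have "0 < j" unfolding j by (simp add: zero_less_divide_iff)
    then have "x = real (nat j) / 2 ^ k" "nat j \<ge> 1" using j by auto
    then have "x \<in> dyadic_grid k" unfolding dyadic_grid_def by blast
    moreover have "x \<in> {real k..<real k + 1}" using sub[OF x] by simp
    ultimately have "x \<in> Lambda_tilde" using mk(2) unfolding Lambda_tilde_def by blast
    then show "x \<in> Lambda_tilde \<inter> dyadic_ivl m i" using x by blast
  qed
  moreover have "card ((\<lambda>j :: int. of_int j / 2 ^ k :: real) ` ?J) = 2 ^ (k - m)"
    using inj by (subst card_image) (auto intro: inj_on_subset simp: algebra_simps nat_power_eq)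
  ultimately show "finite (Lambda_tilde \<inter> dyadic_ivl m i)" "card (Lambda_tilde \<inter> dyadic_ivl m i) = 2 ^ (k - m)"
    by simp_all
qed

text \<open>The threshold for \<open>k\<close> may depend on \<open>m\<close>, but \<open>c\<close>
  may not: later \<open>m\<close> comes from \<open>dyadic_density\<close> with a tolerance that
  already involves \<open>c\<close>.\<close>

definition dyadically_dense :: "real \<Rightarrow> real set \<Rightarrow> bool" where
  "dyadically_dense c L \<longleftrightarrow> (\<forall>m. \<forall>\<^sub>F k in sequentially. \<forall>i::int.
     int k * 2 ^ m \<le> i \<and> i < (int k + 1) * 2 ^ m \<longrightarrow> c * 2 ^ k / 2 ^ m \<le> real (card (L \<inter> dyadic_ivl m i)))"

text \<open>For fixed \<open>m\<close>, the lower tail bound is summed over the \<open>2 ^ m\<close>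
  intervals in \<open>[k, k + 1)\<close>, and the result is summable in \<open>k\<close>.
  Borel-Cantelli gives an almost sure event for each \<open>m\<close>, and there are countably many
  \<open>m\<close>.\<close>

lemma AE_dyadically_dense:
  assumes p: "0 < p" "p < 1"
  obtains c where "c > 0" "AE \<omega> in selection_measure p. dyadically_dense c (selected Lambda_tilde \<omega>)"
proof -
  let ?M = "selection_measure p"
  interpret prob_space ?M by (rule prob_space_selection_measure)
  let ?l = "increasing_enum Lambda_tilde"
  have inj: "inj ?l" using increasing_enum_Lambda_tilde(1) by (rule strict_mono_imp_inj_on)
  define t where "t = p * (1 - exp (- 1))"
  have t: "0 < t" "t < 1"
    using p mult_strict_mono[of p 1 "1 - exp (- 1)" 1] by (simp_all add: t_def)
  define c where "c = - ln (1 - t) / 2"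
  have c: "c > 0" "exp (- 2 * c) = 1 - p * (1 - exp (- 1))"
    using t by (simp_all add: c_def flip: t_def)
  define Idx where "Idx m i = {n. ?l n \<in> dyadic_ivl m i}" for m i
  have img: "?l ` Idx m i = Lambda_tilde \<inter> dyadic_ivl m i" for m i
    using increasing_enum_Lambda_tilde(2) by (auto simp: Idx_def)
  have cardIdx: "finite (Idx m i)" "card (Idx m i) = 2 ^ (k - m)"
    if "m \<le> k" "1 \<le> k" "int k * 2 ^ m \<le> i" "i < (int k + 1) * 2 ^ m" for m k i
  proof -
    have inj': "inj_on ?l (Idx m i)" using inj by (rule inj_on_subset) simp
    show "finite (Idx m i)"
      using card_Lambda_tilde_dyadic_ivl(1)[OF that] unfolding img[symmetric] finite_image_iff[OF inj'] .
    show "card (Idx m i) = 2 ^ (k - m)"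
      using card_Lambda_tilde_dyadic_ivl(2)[OF that] unfolding img[symmetric] card_image[OF inj'] .
  qed
  have cardsel: "card (selected Lambda_tilde \<omega> \<inter> dyadic_ivl m i) = card {n \<in> Idx m i. \<omega> n}" for \<omega> m i
  proof -
    have "selected Lambda_tilde \<omega> \<inter> dyadic_ivl m i = ?l ` {n \<in> Idx m i. \<omega> n}"
      by (auto simp: selected_def Idx_def)
    then show ?thesis using inj by (simp add: card_image inj_on_subset[OF _ subset_UNIV])
  qed
  define Y where "Y m i = {\<omega>. real (card {n \<in> Idx m i. \<omega> n}) < c * real (card (Idx m i))}" for m i
  define I where "I m k = {int k * 2 ^ m..<(int k + 1) * 2 ^ m}" for m k :: nat
  have cardI: "finite (I m k)" "card (I m k) = 2 ^ m" for m k
    by (simp_all add: I_def algebra_simps nat_power_eq)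
  \<comment> \<open>Putting \<open>k = n + (m + 1)\<close> guarantees \<open>m \<le> k\<close> and
    \<open>1 \<le> k\<close>, and makes every index set have \<open>2 ^ (n + 1)\<close>
    elements.\<close>
  define Z where "Z m n = (\<Union>i\<in>I m (n + (m + 1)). Y m i)" for m n
  have Ym: "Y m i \<in> sets ?M" if "finite (Idx m i)" for m i
  proof -
    have "card {n \<in> Idx m i. \<omega> n} = (\<Sum>n\<in>Idx m i. if \<omega> n then 1 else 0)" for \<omega>
      using that by (simp add: sum.If_cases Int_def)
    then have "Measurable.pred ?M (\<lambda>\<omega>. real (card {n \<in> Idx m i. \<omega> n}) < c * real (card (Idx m i)))" by simp
    from predE[OF this] show ?thesis by (simp add: Y_def)
  qed
  have Zm: "Z m n \<in> sets ?M" for m n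
    unfolding Z_def by (intro sets.finite_UN cardI Ym) (auto simp: I_def intro!: cardIdx(1)[of m "n + (m + 1)"])
  have Zle: "measure ?M (Z m n) \<le> 2 ^ m * exp (- c) ^ n" for m n
  proof -
    let ?k = "n + (m + 1)"
    have i: "finite (Idx m i)" "card (Idx m i) = 2 ^ (n + 1)" if "i \<in> I m ?k" for i
      using cardIdx[of m ?k i] that by (simp_all add: I_def)
    have "measure ?M (Z m n) \<le> (\<Sum>i\<in>I m ?k. measure ?M (Y m i))"
      unfolding Z_def using i by (intro finite_measure_subadditive_finite cardI) (auto intro: Ym)
    also have "\<dots> \<le> (\<Sum>i\<in>I m ?k. exp (- c) ^ n)"
    proof (rule sum_mono)
      fix i assume ii: "i \<in> I m ?k"
      have "measure ?M (Y m i) \<le> exp (- c * 2 ^ (n + 1))"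
        using selection_lower_tail[OF p i(1)[OF ii] c(2)] i(2)[OF ii] by (simp add: Y_def)
      \<comment> \<open>This crude bound replaces the doubly exponential decay by a geometric
        series.\<close>
      also have "real n \<le> 2 ^ (n + 1)"
        using of_nat_less_two_power[of "n + 1", where 'a = real] by simp
      then have "exp (- c * 2 ^ (n + 1)) \<le> exp (- c * real n)" using c by simp
      also have "\<dots> = exp (- c) ^ n" by (simp add: mult.commute flip: exp_of_nat_mult)
      finally show "measure ?M (Y m i) \<le> exp (- c) ^ n" .
    qed
    finally show ?thesis by (simp add: cardI)
  qed
  have "AE \<omega> in ?M. \<forall>\<^sub>F n in sequentially. \<omega> \<in> space ?M - Z m n" for m
  proof (rule borel_cantelli_AE1)
    have "summable (\<lambda>n. 2 ^ m * exp (- c) ^ n)" using c by (intro summable_mult summable_geometric) simp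
    then show "summable (\<lambda>n. measure ?M (Z m n))"
      by (rule summable_comparison_test') (use Zle in simp)
  qed (auto simp: Zm emeasure_eq_measure)
  then have "AE \<omega> in ?M. \<forall>m. \<forall>\<^sub>F n in sequentially. \<omega> \<in> space ?M - Z m n"
    by (simp add: AE_all_countable)
  then have "AE \<omega> in ?M. dyadically_dense c (selected Lambda_tilde \<omega>)"
  proof (rule AE_mp, intro AE_I2 impI)
    fix \<omega> assume ev: "\<forall>m. \<forall>\<^sub>F n in sequentially. \<omega> \<in> space ?M - Z m n"
    show "dyadically_dense c (selected Lambda_tilde \<omega>)"
      unfolding dyadically_dense_def
    proof
      fix m
      let ?P = "\<lambda>k. \<forall>i::int. int k * 2 ^ m \<le> i \<and> i < (int k + 1) * 2 ^ m \<longrightarrow>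
        c * 2 ^ k / 2 ^ m \<le> real (card (selected Lambda_tilde \<omega> \<inter> dyadic_ivl m i))"
      have "\<forall>\<^sub>F n in sequentially. ?P (n + (m + 1))"
        using ev[rule_format, of m]
      proof (rule eventually_mono, intro allI impI)
        fix n i assume *: "\<omega> \<in> space ?M - Z m n"
          and i: "int (n + (m + 1)) * 2 ^ m \<le> i \<and> i < (int (n + (m + 1)) + 1) * 2 ^ m"
        then have "\<omega> \<notin> Y m i" by (auto simp: Z_def I_def)
        moreover have "card (Idx m i) = 2 ^ (n + 1)" using cardIdx(2)[of m "n + (m + 1)" i] i by simp
        ultimately show "c * 2 ^ (n + (m + 1)) / 2 ^ m \<le> real (card (selected Lambda_tilde \<omega> \<inter> dyadic_ivl m i))"
          by (simp add: cardsel Y_def power_add not_less)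
      qed
      then show "eventually ?P sequentially" using eventually_sequentially_seg[of ?P "m + 1"] by blast
    qed
  qed
  with c(1) show thesis by (rule that)
qed

subsection \<open>Counting points of translates\<close>

lemma finite_Lambda_tilde_atMost: "finite (Lambda_tilde \<inter> {..x})"
proof -
  define q where "q = nat \<lceil>x\<rceil>"
  have "Lambda_tilde \<inter> {..x} \<subseteq> (\<lambda>j :: int. of_int j / 2 ^ q) ` {0..\<lceil>x * 2 ^ q\<rceil>}"
  proof
    fix y assume y: "y \<in> Lambda_tilde \<inter> {..x}"
    then have "y < real q + 1" unfolding q_def by simp linarith
    with y obtain j :: int where j: "y = of_int j / 2 ^ q"
      using Lambda_tilde_scaled_int by blast
    have "0 \<le> y" using y by (auto simp: Lambda_tilde_def)
    then have "0 \<le> j" using mult_nonneg_nonneg[of y "2 ^ q"] unfolding j by simp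
    moreover have "of_int j \<le> x * 2 ^ q" using y unfolding j by (simp add: pos_divide_le_eq)
    then have "j \<le> \<lceil>x * 2 ^ q\<rceil>" by linarith
    ultimately show "y \<in> (\<lambda>j :: int. of_int j / 2 ^ q) ` {0..\<lceil>x * 2 ^ q\<rceil>}" using j by auto
  qed
  then show ?thesis by (rule finite_subset) simp
qed

lemma countable_Lambda_tilde: "countable Lambda_tilde"
proof -
  have "countable (range (increasing_enum Lambda_tilde))" by simp
  then show ?thesis unfolding increasing_enum_Lambda_tilde(2) .
qed

text \<open>This is the weight of \<open>F y\<close> when a sum of translates of \<open>F\<close>
  over \<open>L\<close> is integrated over \<open>S\<close> and
  \<open>nn_integral_sum_translates\<close> is applied.\<close>

definition shift_count :: "real set \<Rightarrow> real set \<Rightarrow> real \<Rightarrow> ennreal" where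
  "shift_count L S y = (\<integral>\<^sup>+l. indicator S (y - l) \<partial>count_space L)"

lemma shift_count_eq_emeasure: "shift_count L S y = emeasure (count_space UNIV) {l \<in> L. y - l \<in> S}"
proof -
  have "shift_count L S y = (\<integral>\<^sup>+l. indicator {l \<in> L. y - l \<in> S} l \<partial>count_space UNIV)"
    unfolding shift_count_def
    by (subst nn_integral_count_space_indicator, simp, rule nn_integral_cong) (auto split: split_indicator)
  then show ?thesis by simp
qed

text \<open>Both \<open>l0\<close> and \<open>l\<close> lie on the grid of step
  \<open>1 / 2 ^ q\<close>, so \<open>x + l0 - l\<close> is in the coset of \<open>x\<close>, and
  distinct \<open>l\<close> give distinct points of it.\<close>

lemma emeasure_count_le_hits:
  assumes T: "T \<subseteq> {l \<in> Lambda_tilde. l < real q + 1 \<and> x + l0 - l \<in> S}"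
    and l0: "l0 \<in> Lambda_tilde" "l0 < real q + 1"
  shows "emeasure (count_space UNIV) T \<le> hits q S x"
proof -
  let ?H = "{j :: int. x + of_int j / 2 ^ q \<in> S}"
  define f where "f l = \<lfloor>(l0 - l) * 2 ^ q\<rfloor>" for l :: real
  have f: "of_int (f l) / 2 ^ q = l0 - l" if l: "l \<in> T" for l
  proof -
    have "l \<in> Lambda_tilde" "l < real q + 1" using l T by auto
    then obtain j :: int where "l = of_int j / 2 ^ q" by (rule Lambda_tilde_scaled_int)
    moreover obtain j0 :: int where "l0 = of_int j0 / 2 ^ q" using l0 by (rule Lambda_tilde_scaled_int)
    ultimately have *: "l0 - l = of_int (j0 - j) / 2 ^ q" by (simp add: diff_divide_distrib)
    then have "(l0 - l) * 2 ^ q = of_int (j0 - j)" by simp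
    then have "f l = j0 - j" unfolding f_def by (simp only: floor_of_int)
    with * show ?thesis by simp
  qed
  have inj: "inj_on f T"
  proof (rule inj_onI)
    fix a b assume "a \<in> T" "b \<in> T" "f a = f b"
    then have "l0 - a = l0 - b" using f by metis
    then show "a = b" by simp
  qed
  have sub: "f ` T \<subseteq> ?H"
  proof
    fix j assume "j \<in> f ` T"
    then obtain l where l: "l \<in> T" "j = f l" by blast
    then have "x + of_int j / 2 ^ q = x + l0 - l" using f by simp
    moreover have "x + l0 - l \<in> S" using l T by blast
    ultimately show "j \<in> ?H" by (simp only: mem_Collect_eq)
  qed
  show ?thesis
  proof (cases "finite ?H")
    case True
    then have "finite T" using inj sub by (meson finite_imageD finite_subset)
    moreover have "card T \<le> card ?H" using inj sub True by (rule card_inj_on_le)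
    ultimately show ?thesis using True by (simp add: hits_eq_emeasure)
  next
    case False
    then show ?thesis by (simp add: hits_eq_emeasure)
  qed
qed

text \<open>The set \<open>x + l - I\<close> contains a dyadic interval of length \<open>1 / 2 ^ (m + 1)\<close>. It has at least
  twice as many points of \<open>L\<close> as the coset of \<open>x\<close> has points in \<open>I - E\<close>. The extra factor
  \<open>2 ^ (2 * R)\<close> accounts for \<open>l\<close> and this interval lying up to \<open>2 * R\<close> levels apart.\<close>

lemma shift_count_lower:
  fixes R m k' k1 :: nat and i :: int and c x l :: real
  defines "I \<equiv> dyadic_ivl m i"
  assumes L: "L \<subseteq> Lambda_tilde" and c: "c > 0"
    and I: "I \<subseteq> {-real R..<real R}" and x: "x \<in> {-real R..<real R}"
    and l: "l \<in> L" "real k' \<le> l" "l < real k' + 1"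
    and few: "\<And>q. hits q (I - E) x \<le> ennreal (c / 2 ^ (m + 3 + 2 * R) * 2 ^ q)"
    and dense: "\<And>k j. k \<ge> k1 \<Longrightarrow> int k * 2 ^ (m + 1) \<le> j \<Longrightarrow> j < (int k + 1) * 2 ^ (m + 1) \<Longrightarrow>
      c * 2 ^ k / 2 ^ (m + 1) \<le> real (card (L \<inter> dyadic_ivl (m + 1) j))"
    and k': "k1 + 2 * R \<le> k'"
  shows "ennreal (c * 2 ^ k' / 2 ^ (m + 2 + 2 * R)) \<le> shift_count L E (x + l)"
proof -
  define y where "y = x + l"
  \<comment> \<open>Scaled by \<open>2 ^ (m + 1)\<close>, and with \<open>Y\<close> the scaled
    \<open>y\<close>, the set \<open>y - I\<close> is the interval from \<open>Y - 2 * i - 2\<close>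
    (excluded) to \<open>Y - 2 * i\<close> (included). Having length 2, it contains the unit
    interval that starts at the integer \<open>j\<close>.\<close>
  define j where "j = \<lfloor>y * 2 ^ (m + 1)\<rfloor> - 2 * i - 1"
  let ?J = "dyadic_ivl (m + 1) j"
  have JI: "y - z \<in> I" if z: "z \<in> ?J" for z
  proof -
    have "real_of_int j \<le> z * 2 ^ (m + 1)" "z * 2 ^ (m + 1) < real_of_int j + 1"
      using z by (auto simp: mem_dyadic_ivl_iff)
    moreover have "real_of_int j \<le> y * 2 ^ (m + 1) - 2 * real_of_int i - 1"
      "y * 2 ^ (m + 1) - 2 * real_of_int i - 2 < real_of_int j"
      unfolding j_def by linarith+
    ultimately have "2 * real_of_int i \<le> (y - z) * 2 ^ (m + 1)" "(y - z) * 2 ^ (m + 1) < 2 * real_of_int i + 2"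
      by (simp_all add: left_diff_distrib)
    then have "real_of_int i \<le> (y - z) * 2 ^ m" "(y - z) * 2 ^ m < real_of_int i + 1" by simp_all
    then have "i = \<lfloor>(y - z) * 2 ^ m\<rfloor>" by linarith
    then show ?thesis by (simp add: I_def mem_dyadic_ivl_iff)
  qed
  define k where "k = j div 2 ^ (m + 1)"
  have kj: "k * 2 ^ (m + 1) \<le> j" "j < (k + 1) * 2 ^ (m + 1)"
  proof -
    have "0 < (2 :: int) ^ (m + 1)" by simp
    from pos_mod_bound[OF this, of j] pos_mod_sign[OF this, of j] div_mult_mod_eq[of j "2 ^ (m + 1)"]
    show "k * 2 ^ (m + 1) \<le> j" "j < (k + 1) * 2 ^ (m + 1)"
      unfolding k_def distrib_right mult_1 by linarith+
  qed
  have Jk: "real_of_int k \<le> z" "z < real_of_int k + 1" if z: "z \<in> ?J" for z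
  proof -
    have "real_of_int (k * 2 ^ (m + 1)) \<le> real_of_int j" "real_of_int (j + 1) \<le> real_of_int ((k + 1) * 2 ^ (m + 1))"
      using kj unfolding of_int_le_iff by linarith+
    then have "real_of_int k * 2 ^ (m + 1) \<le> real_of_int j" "real_of_int j + 1 \<le> (real_of_int k + 1) * 2 ^ (m + 1)"
      by simp_all
    moreover have "real_of_int j \<le> z * 2 ^ (m + 1)" "z * 2 ^ (m + 1) < real_of_int j + 1"
      using z by (auto simp: mem_dyadic_ivl_iff)
    ultimately have "real_of_int k * 2 ^ (m + 1) \<le> z * 2 ^ (m + 1)"
      "z * 2 ^ (m + 1) < (real_of_int k + 1) * 2 ^ (m + 1)" by linarith+
    then show "real_of_int k \<le> z" "z < real_of_int k + 1"
      by (auto dest: mult_right_le_imp_le mult_right_less_imp_less)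
  qed
  define z0 where "z0 = real_of_int j / 2 ^ (m + 1)"
  have z0: "z0 \<in> ?J" by (simp add: z0_def mem_dyadic_ivl_iff)
  have "- real R \<le> y - z0" "y - z0 < real R" using JI[OF z0] I by auto
  moreover have "real k' - real R \<le> y" "y < real k' + 1 + real R" using x l by (auto simp: y_def)
  ultimately have "real k' - 2 * real R < real_of_int k + 1" "real_of_int k < real k' + 1 + 2 * real R"
    using Jk[OF z0] by linarith+
  \<comment> \<open>\<open>y\<close> is within \<open>R\<close> of \<open>l\<close> up to rounding,
    and \<open>y - z0\<close> is within \<open>R\<close> of 0; hence the levels \<open>k\<close> of
    the dyadic interval and \<open>k'\<close> of \<open>l\<close> differ by at most
    \<open>2 * R\<close>.\<close>
  then have k: "int k' \<le> k + 2 * int R" "k \<le> int k' + 2 * int R" by linarith+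
  define n where "n = nat k"
  have n: "k = int n" "k1 \<le> n" "k' \<le> n + 2 * R" using k k' unfolding n_def by linarith+
  \<comment> \<open>Fine enough that \<open>l\<close> and all points of the dyadic interval lie on
    the grid of step \<open>1 / 2 ^ q\<close>.\<close>
  define q where "q = n + 2 * R + 1"
  let ?T = "{z \<in> L \<inter> ?J. y - z \<in> I - E}" and ?G = "{z \<in> L \<inter> ?J. y - z \<in> E}"
  have big: "c * 2 ^ n / 2 ^ (m + 1) \<le> real (card (L \<inter> ?J))"
    using dense[of n j] kj n by simp
  moreover have "0 < c * 2 ^ n / 2 ^ (m + 1)" using c by simp
  ultimately have "card (L \<inter> ?J) > 0" by linarith
  then have fin: "finite (L \<inter> ?J)" by (rule card_ge_0_finite)
  have "L \<inter> ?J = ?T \<union> ?G" using JI by auto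
  then have card: "card (L \<inter> ?J) \<le> card ?T + card ?G" by (metis card_Un_le)
  have "emeasure (count_space UNIV) ?T \<le> hits q (I - E) x"
  proof (rule emeasure_count_le_hits[of _ _ _ l])
    show "?T \<subseteq> {z \<in> Lambda_tilde. z < real q + 1 \<and> x + l - z \<in> I - E}"
      using L Jk n by (force simp: y_def q_def)
    show "l \<in> Lambda_tilde" using L l by blast
    have "real k' \<le> real n + 2 * real R" using n(3) by linarith
    then show "l < real q + 1" using l unfolding q_def by simp
  qed
  also have "\<dots> \<le> ennreal (c / 2 ^ (m + 3 + 2 * R) * 2 ^ q)" by (rule few)
  \<comment> \<open>The exponent in \<open>few\<close> is chosen for this value: half of the
    guaranteed number \<open>c * 2 ^ n / 2 ^ (m + 1)\<close> of points, so at least the other half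
    falls in \<open>y - E\<close>.\<close>
  also have "c / 2 ^ (m + 3 + 2 * R) * 2 ^ q = c * 2 ^ n / 2 ^ (m + 2)"
    by (simp add: q_def power_add)
  also have "emeasure (count_space UNIV) ?T = ennreal (real (card ?T))"
    using finite_subset[OF _ fin, of ?T] by (subst emeasure_count_space_finite) (auto simp: ennreal_of_nat_eq_real_of_nat)
  finally have "real (card ?T) \<le> c * 2 ^ n / 2 ^ (m + 2)"
    using c by (subst (asm) ennreal_le_iff) simp_all
  moreover have "(2 :: real) ^ (m + 2) = 2 * 2 ^ (m + 1)" by simp
  then have "c * 2 ^ n / 2 ^ (m + 1) = 2 * (c * 2 ^ n / 2 ^ (m + 2))" by simp
  ultimately have G: "c * 2 ^ n / 2 ^ (m + 2) \<le> real (card ?G)" using big card by linarith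
  have "c * 2 ^ k' / 2 ^ (m + 2 + 2 * R) \<le> c * 2 ^ (n + 2 * R) / 2 ^ (m + 2 + 2 * R)"
    using c n(3) by (intro divide_right_mono mult_left_mono power_increasing) auto
  also have "\<dots> = c * 2 ^ n / 2 ^ (m + 2)" by (simp add: power_add)
  also note G
  finally have "ennreal (c * 2 ^ k' / 2 ^ (m + 2 + 2 * R)) \<le> ennreal (real (card ?G))"
    by (rule ennreal_leI)
  also have "\<dots> = emeasure (count_space UNIV) ?G"
    using finite_subset[OF _ fin, of ?G] by (subst emeasure_count_space_finite) (auto simp: ennreal_of_nat_eq_real_of_nat)
  also have "\<dots> \<le> shift_count L E y"
    unfolding shift_count_eq_emeasure by (intro emeasure_mono) auto
  finally show ?thesis by (simp add: y_def)
qed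

text \<open>The counted points lie below \<open>k' + 2 * R + 1\<close>, hence on a common grid with
  \<open>l\<close>. So the count is at most the number of hits of the whole window by the coset of
  \<open>x\<close>.\<close>

lemma shift_count_upper:
  fixes R k' :: nat and x l :: real
  assumes L: "L \<subseteq> Lambda_tilde" and D: "D \<subseteq> {-real R..<real R}" and x: "x \<in> {-real R..<real R}"
    and l: "l \<in> Lambda_tilde" "l < real k' + 1"
  shows "shift_count L D (x + l) \<le> ennreal (2 * real R * 2 ^ (k' + 2 * R + 1))"
proof -
  have "shift_count L D (x + l) \<le> hits (k' + 2 * R + 1) {-real R..<real R} x"
    unfolding shift_count_eq_emeasure
  proof (rule emeasure_count_le_hits[OF _ l(1)])
    show "{la \<in> L. x + l - la \<in> D} \<subseteq>
      {la \<in> Lambda_tilde. la < real (k' + 2 * R + 1) + 1 \<and> x + l - la \<in> {-real R..<real R}}"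
    proof
      fix z assume "z \<in> {la \<in> L. x + l - la \<in> D}"
      then have z: "z \<in> Lambda_tilde" "x + l - z \<in> {-real R..<real R}" using L D by blast+
      have "- real R \<le> x + l - z" "x < real R" using z(2) x by simp_all
      moreover have "real (k' + 2 * R + 1) = real k' + 2 * real R + 1" by simp
      ultimately have "z < real (k' + 2 * R + 1) + 1" using l(2) by linarith
      with z show "z \<in> {la \<in> Lambda_tilde. la < real (k' + 2 * R + 1) + 1 \<and> x + l - la \<in> {-real R..<real R}}"
        by blast
    qed
    show "l < real (k' + 2 * R + 1) + 1" using l(2) by simp
  qed
  also have "\<dots> = ennreal (2 * real R * 2 ^ (k' + 2 * R + 1))"
    using hits_interval[of "- int R" "int R" "k' + 2 * R + 1" x] by simp
  finally show ?thesis .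
qed

text \<open>If the left side is not zero, then \<open>y = x + l\<close> with \<open>x\<close> in
  \<open>D\<close> and \<open>l\<close> in the tail of \<open>L\<close>. The upper bound for
  \<open>D\<close> and the lower bound for \<open>E\<close> are both proportional to
  \<open>2 ^ k'\<close>, where \<open>k'\<close> is the integer part of \<open>l\<close>, so their
  ratio is independent of \<open>y\<close>. Starting the tail at \<open>k1 + 2 * R\<close> keeps all
  levels involved above the density threshold \<open>k1\<close>.\<close>

lemma shift_count_compare:
  fixes R m k1 :: nat and i :: int and c :: real and E :: "real set"
  defines "I \<equiv> dyadic_ivl m i"
  defines "D \<equiv> {x \<in> {-real R..<real R}. \<forall>q. hits q (I - E) x \<le> ennreal (c / 2 ^ (m + 3 + 2 * R) * 2 ^ q)}"
  assumes L: "L \<subseteq> Lambda_tilde" and c: "c > 0"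
    and I: "I \<subseteq> {-real R..<real R}"
    and dense: "\<And>k j. k \<ge> k1 \<Longrightarrow> int k * 2 ^ (m + 1) \<le> j \<Longrightarrow> j < (int k + 1) * 2 ^ (m + 1) \<Longrightarrow>
      c * 2 ^ k / 2 ^ (m + 1) \<le> real (card (L \<inter> dyadic_ivl (m + 1) j))"
  shows "shift_count (L \<inter> {real (k1 + 2 * R)..}) D y \<le> ennreal (2 * real R * 2 ^ (m + 3 + 4 * R) / c) * shift_count L E y"
proof (cases "{l \<in> L \<inter> {real (k1 + 2 * R)..}. y - l \<in> D} = {}")
  case True
  show ?thesis by (simp only: shift_count_eq_emeasure True) simp
next
  case False
  then obtain l where l: "l \<in> L" "real (k1 + 2 * R) \<le> l" and D: "y - l \<in> D" by auto
  define k' where "k' = nat \<lfloor>l\<rfloor>"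
  have "0 \<le> l" using l(2) by (rule order_trans[rotated]) simp
  then have k': "real k' \<le> l" "l < real k' + 1" unfolding k'_def by linarith+
  have k1: "k1 + 2 * R \<le> k'" using l(2) k'(2) by linarith
  have x: "y - l \<in> {-real R..<real R}" using D by (simp add: D_def)
  have "shift_count (L \<inter> {real (k1 + 2 * R)..}) D (y - l + l) \<le> ennreal (2 * real R * 2 ^ (k' + 2 * R + 1))"
    by (rule shift_count_upper[OF _ _ x _ k'(2)]) (use L l D_def in auto)
  also have "2 * real R * 2 ^ (k' + 2 * R + 1) =
      2 * real R * 2 ^ (m + 3 + 4 * R) / c * (c * 2 ^ k' / 2 ^ (m + 2 + 2 * R))"
  proof -
    have "(2 :: real) ^ (m + 3 + 4 * R) * 2 ^ k' = 2 ^ (k' + 2 * R + 1) * 2 ^ (m + 2 + 2 * R)"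
      unfolding power_add[symmetric] by (rule arg_cong[where f = "power 2"]) simp
    then show ?thesis using c by (simp add: field_simps)
  qed
  also have "ennreal \<dots> =
      ennreal (2 * real R * 2 ^ (m + 3 + 4 * R) / c) * ennreal (c * 2 ^ k' / 2 ^ (m + 2 + 2 * R))"
    using c by (intro ennreal_mult) auto
  also have "\<dots> \<le> ennreal (2 * real R * 2 ^ (m + 3 + 4 * R) / c) * shift_count L E (y - l + l)"
  proof (rule mult_left_mono)
    show "ennreal (c * 2 ^ k' / 2 ^ (m + 2 + 2 * R)) \<le> shift_count L E (y - l + l)"
      by (rule shift_count_lower[OF L c I[unfolded I_def] x l(1) k' _ dense k1])
        (use D in \<open>auto simp: D_def I_def\<close>)
  qed simp
  finally show ?thesis by simp
qed

subsection \<open>The zero-one law\<close>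

definition translate_sum :: "(real \<Rightarrow> ennreal) \<Rightarrow> real set \<Rightarrow> real \<Rightarrow> ennreal" where
  "translate_sum F L x = (\<integral>\<^sup>+l. F (x + l) \<partial>count_space L)"

lemma translate_sum_measurable [measurable (raw)]:
  assumes "countable L" and [measurable]: "F \<in> borel_measurable borel"
  shows "translate_sum F L \<in> borel_measurable borel"
  unfolding translate_sum_def [abs_def] using assms(1)
  by (rule borel_measurable_nn_integral_count_space) measurable

lemma shift_count_measurable [measurable (raw)]:
  assumes "countable L" and [measurable]: "S \<in> sets borel"
  shows "shift_count L S \<in> borel_measurable borel"
  unfolding shift_count_def [abs_def] using assms(1)
  by (rule borel_measurable_nn_integral_count_space) measurable

text \<open>Only finitely many points of \<open>L\<close> lie below \<open>a\<close>, and each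
  contributes a finite term.\<close>

lemma translate_sum_tail_finite:
  assumes L: "L \<subseteq> Lambda_tilde" and F: "\<And>x. F x < \<infinity>" and fin: "translate_sum F (L \<inter> {a..}) x < \<infinity>"
  shows "translate_sum F L x < \<infinity>"
proof -
  let ?A = "L \<inter> {..<a}"
  have A: "finite ?A" using finite_Lambda_tilde_atMost[of a] by (rule rev_finite_subset) (use L in auto)
  have "translate_sum F L x = (\<integral>\<^sup>+l. F (x + l) * indicator L l \<partial>count_space UNIV)"
    unfolding translate_sum_def by (subst nn_integral_count_space_indicator) simp_all
  also have "\<dots> = (\<integral>\<^sup>+l. F (x + l) * indicator (L \<inter> {a..}) l + F (x + l) * indicator ?A l \<partial>count_space UNIV)"
    by (intro nn_integral_cong) (auto split: split_indicator)
  also have "\<dots> = (\<integral>\<^sup>+l. F (x + l) * indicator (L \<inter> {a..}) l \<partial>count_space UNIV) +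
      (\<integral>\<^sup>+l. F (x + l) * indicator ?A l \<partial>count_space UNIV)"
    by (intro nn_integral_add) auto
  also have "(\<integral>\<^sup>+l. F (x + l) * indicator (L \<inter> {a..}) l \<partial>count_space UNIV) = translate_sum F (L \<inter> {a..}) x"
    unfolding translate_sum_def by (subst nn_integral_count_space_indicator) simp_all
  also have "(\<integral>\<^sup>+l. F (x + l) * indicator ?A l \<partial>count_space UNIV) = (\<Sum>l\<in>?A. F (x + l))"
    using A by (simp add: nn_integral_indicator_finite)
  also have "translate_sum F (L \<inter> {a..}) x + (\<Sum>l\<in>?A. F (x + l)) < \<infinity>"
    using fin F A by (simp add: less_top[symmetric])
  finally show ?thesis .
qed

text \<open>The window is split into \<open>B\<close>, which the maximal inequality makes small, and
  \<open>D\<close>, where a tail of the sum has finite integral. Divergence can then happen only in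
  \<open>B\<close>, up to a null set.\<close>

lemma emeasure_divergence_le:
  fixes c e :: real and R :: nat
  assumes L: "L \<subseteq> Lambda_tilde" and dense: "dyadically_dense c L" and c: "c > 0"
    and F[measurable]: "F \<in> borel_measurable borel" and Ffin: "\<And>x. F x < \<infinity>"
    and E[measurable]: "E \<in> sets borel" and ER: "E \<subseteq> {-real R..<real R}" and Epos: "0 < emeasure lborel E"
    and int: "(\<integral>\<^sup>+x. indicator E x * translate_sum F L x \<partial>lborel) < \<infinity>"
    and e: "e > 0"
  shows "emeasure lborel {x \<in> {-real R..<real R}. translate_sum F L x = \<infinity>} \<le> ennreal e"
proof -
  let ?W = "{-real R..<real R}"
  have cL: "countable L" using L countable_Lambda_tilde countable_subset by blast
  then have cL': "countable (L \<inter> A)" for A by (rule countable_subset[rotated]) blast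
  have [measurable]: "translate_sum F L \<in> borel_measurable borel" using cL by measurable
  have [measurable]: "translate_sum F (L \<inter> {a..}) \<in> borel_measurable borel" for a using cL' by measurable
  have R: "R > 0" using ER Epos by (cases "R = 0") auto
  have "emeasure lborel E \<le> emeasure lborel ?W" using ER by (intro emeasure_mono) auto
  also have "\<dots> < \<infinity>" by simp
  finally have Efin: "emeasure lborel E < \<infinity>" .
  \<comment> \<open>Solves \<open>2 * R * (e' / 2 ^ m) = d * e\<close> for the \<open>d\<close>
    below. The powers of 2 involving \<open>m\<close> cancel, so \<open>e'\<close> can be fixed
    before \<open>m\<close> is obtained.\<close>
  define e' where "e' = e * c / (2 * real R * 2 ^ (3 + 2 * R))"
  have "e' > 0" using e c R by (simp add: e'_def)
  obtain m i where mi: "E \<inter> dyadic_ivl m i \<noteq> {}"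
      "emeasure lborel (dyadic_ivl m i - E) \<le> ennreal (e' / 2 ^ m)"
    by (rule dyadic_density[OF E Epos Efin \<open>e' > 0\<close>])
  define I where "I = dyadic_ivl m i"
  \<comment> \<open>The interval meets \<open>E\<close> and hence the window, whose integer
    endpoints are dyadic at every level; so it cannot cross the boundary.\<close>
  have I: "I \<subseteq> ?W"
  proof -
    obtain z where "z \<in> E" "z \<in> dyadic_ivl m i" using mi(1) by blast
    then have z: "z \<in> ?W" "z \<in> I" using ER unfolding I_def by blast+
    have i: "i = \<lfloor>z * 2 ^ m\<rfloor>" using z(2) by (simp add: I_def mem_dyadic_ivl_iff)
    have "- real R * 2 ^ m \<le> z * 2 ^ m"
      using z(1) by (intro mult_right_mono) simp_all
    moreover have "z * 2 ^ m < real R * 2 ^ m"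
      using z(1) by (intro mult_strict_right_mono) simp_all
    ultimately have "of_int (- int R * 2 ^ m) \<le> z * 2 ^ m" "z * 2 ^ m < of_int (int R * 2 ^ m)"
      by simp_all
    then have "- int R * 2 ^ m \<le> i" "i < int R * 2 ^ m"
      unfolding i by (simp_all only: le_floor_iff floor_less_iff)
    then have "real_of_int (- int R * 2 ^ m) \<le> real_of_int i" "real_of_int (i + 1) \<le> real_of_int (int R * 2 ^ m)"
      unfolding of_int_le_iff by linarith+
    then have "- real R \<le> of_int i / 2 ^ m" "(of_int i + 1) / 2 ^ m \<le> real R"
      by (simp_all add: pos_le_divide_eq pos_divide_le_eq)
    then show ?thesis by (auto simp: I_def dyadic_ivl_def)
  qed
  define d where "d = c / 2 ^ (m + 3 + 2 * R)"
  have d: "d > 0" using c by (simp add: d_def)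
  define B where "B = {x. \<exists>q. hits q (I - E) x > ennreal (d * 2 ^ q)}"
  have [measurable]: "I \<in> sets borel" by (simp add: I_def)
  have [measurable]: "B \<in> sets borel" unfolding B_def by measurable
  have "ennreal d * emeasure lborel (B \<inter> ?W) \<le> ennreal (2 * real R) * emeasure lborel (I - E)"
    unfolding B_def using d by (intro emeasure_hits_maximal) auto
  also have "\<dots> \<le> ennreal (2 * real R) * ennreal (e' / 2 ^ m)"
    using mi(2) by (intro mult_left_mono) (auto simp: I_def)
  also have "\<dots> = ennreal (2 * real R * (e' / 2 ^ m))"
    using \<open>e' > 0\<close> by (intro ennreal_mult[symmetric]) auto
  also have "2 * real R * (e' / 2 ^ m) = d * e"
    using R by (simp add: e'_def d_def power_add)
  also have "ennreal (d * e) = ennreal d * ennreal e" using d e by (simp add: ennreal_mult)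
  finally have B: "emeasure lborel (B \<inter> ?W) \<le> ennreal e"
    using d by (subst (asm) ennreal_mult_le_mult_iff) auto
  obtain k1 where k1: "\<And>k j. k \<ge> k1 \<Longrightarrow> int k * 2 ^ (m + 1) \<le> j \<Longrightarrow> j < (int k + 1) * 2 ^ (m + 1) \<Longrightarrow>
      c * 2 ^ k / 2 ^ (m + 1) \<le> real (card (L \<inter> dyadic_ivl (m + 1) j))"
    using dense unfolding dyadically_dense_def eventually_sequentially by meson
  define D where "D = {x \<in> ?W. \<forall>q. hits q (I - E) x \<le> ennreal (c / 2 ^ (m + 3 + 2 * R) * 2 ^ q)}"
  have D: "D = ?W - B" unfolding D_def B_def d_def not_less[symmetric] by blast
  then have [measurable]: "D \<in> sets borel" by simp
  define L0 where "L0 = L \<inter> {real (k1 + 2 * R)..}"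
  define C where "C = ennreal (2 * real R * 2 ^ (m + 3 + 4 * R) / c)"
  have cmp: "shift_count L0 D y \<le> C * shift_count L E y" for y
    unfolding L0_def D_def C_def I_def using L c I[unfolded I_def] k1 by (rule shift_count_compare)
  have [measurable]: "shift_count L E \<in> borel_measurable borel" using cL by measurable
  \<comment> \<open>Duality twice: pass from the integral over \<open>D\<close> to a weighted
    integral of \<open>F\<close>, compare the weights, and return to the integral over
    \<open>E\<close>.\<close>
  have "(\<integral>\<^sup>+x. indicator D x * translate_sum F L0 x \<partial>lborel) = (\<integral>\<^sup>+y. F y * shift_count L0 D y \<partial>lborel)"
    unfolding translate_sum_def shift_count_def using cL'[of "{real (k1 + 2 * R)..}"]
    by (intro nn_integral_sum_translates) (auto simp: L0_def)
  also have "\<dots> \<le> (\<integral>\<^sup>+y. C * (F y * shift_count L E y) \<partial>lborel)"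
    using cmp by (intro nn_integral_mono) (auto simp: mult.left_commute[of C] intro: mult_left_mono)
  also have "\<dots> = C * (\<integral>\<^sup>+y. F y * shift_count L E y \<partial>lborel)"
    by (rule nn_integral_cmult) measurable
  also have "(\<integral>\<^sup>+y. F y * shift_count L E y \<partial>lborel) = (\<integral>\<^sup>+x. indicator E x * translate_sum F L x \<partial>lborel)"
    unfolding translate_sum_def shift_count_def using cL
    by (intro nn_integral_sum_translates[symmetric]) auto
  also have "C * \<dots> < \<infinity>" using int by (simp add: C_def ennreal_mult_less_top)
  finally have fin: "(\<integral>\<^sup>+x. indicator D x * translate_sum F L0 x \<partial>lborel) \<noteq> \<infinity>" by simp
  have [measurable]: "translate_sum F L0 \<in> borel_measurable borel" unfolding L0_def by measurable
  have "AE x in lborel. indicator D x * translate_sum F L0 x \<noteq> \<infinity>"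
    by (rule nn_integral_PInf_AE[OF _ fin]) measurable
  then have "AE x in lborel. x \<in> {x \<in> ?W. translate_sum F L x = \<infinity>} \<longrightarrow> x \<in> B \<inter> ?W"
  proof eventually_elim
    case (elim x)
    have "translate_sum F L x < \<infinity>" if "x \<in> D"
    proof -
      have "translate_sum F L0 x < \<infinity>" using elim that by (simp add: less_top)
      then show ?thesis
        unfolding L0_def by (rule translate_sum_tail_finite[where F = F, OF L Ffin])
    qed
    then show ?case unfolding D by (cases "x \<in> B") auto
  qed
  then have "emeasure lborel {x \<in> ?W. translate_sum F L x = \<infinity>} \<le> emeasure lborel (B \<inter> ?W)"
    by (rule emeasure_mono_AE) measurable
  with B show ?thesis by (rule order_trans[rotated])
qed

text \<open>The sets \<open>E N\<close> exhaust the points of convergence. If all are null, the sum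
  diverges almost everywhere. Otherwise one \<open>E N\<close> of positive measure, on which the sum
  has finite integral, controls divergence in every larger window up to an arbitrarily small
  error.\<close>

lemma zero_one_borel:
  assumes L: "L \<subseteq> Lambda_tilde" and dense: "dyadically_dense c L" and c: "c > 0"
    and F[measurable]: "F \<in> borel_measurable borel" and Ffin: "\<And>x. F x < \<infinity>"
  shows "(AE x in lborel. translate_sum F L x = \<infinity>) \<or> (AE x in lborel. translate_sum F L x < \<infinity>)"
proof -
  have cL: "countable L" using L countable_Lambda_tilde countable_subset by blast
  have [measurable]: "translate_sum F L \<in> borel_measurable borel" using cL by measurable
  define E where "E N = {x \<in> {-real N..<real N}. translate_sum F L x \<le> of_nat N}" for N
  have [measurable]: "E N \<in> sets borel" for N unfolding E_def by measurable
  show ?thesis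
  proof (cases "\<exists>N. 0 < emeasure lborel (E N)")
    case False
    then have "E N \<in> null_sets lborel" for N by (auto simp: null_sets_def)
    then have "AE x in lborel. \<forall>N. x \<notin> E N" by (simp add: AE_all_countable AE_not_in)
    then have "AE x in lborel. translate_sum F L x = \<infinity>"
    proof eventually_elim
      case (elim x)
      show ?case
      proof (cases "translate_sum F L x")
        case (real r)
        obtain N where "max r (\<bar>x\<bar> + 1) \<le> real N" using real_arch_simple by blast
        then have "x \<in> E N" using real by (auto simp: E_def ennreal_of_nat_eq_real_of_nat ennreal_leI)
        with elim show ?thesis by blast
      qed simp
    qed
    then show ?thesis ..
  next
    case True
    then obtain N where N: "0 < emeasure lborel (E N)" by blast
    have "(\<integral>\<^sup>+x. indicator (E N) x * translate_sum F L x \<partial>lborel) \<le> (\<integral>\<^sup>+x. of_nat N * indicator {-real N..<real N} x \<partial>lborel)"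
      by (intro nn_integral_mono) (auto simp: E_def split: split_indicator)
    also have "\<dots> < \<infinity>" by (simp add: nn_integral_cmult ennreal_mult_less_top ennreal_of_nat_eq_real_of_nat)
    finally have int: "(\<integral>\<^sup>+x. indicator (E N) x * translate_sum F L x \<partial>lborel) < \<infinity>" .
    \<comment> \<open>Windows of radius \<open>N + n\<close> still contain \<open>E N\<close> and
      exhaust the line as \<open>n\<close> grows.\<close>
    have null: "{x \<in> {-real (N + n)..<real (N + n)}. translate_sum F L x = \<infinity>} \<in> null_sets lborel" for n
    proof -
      let ?Z = "{x \<in> {-real (N + n)..<real (N + n)}. translate_sum F L x = \<infinity>}"
      have sub: "E N \<subseteq> {-real (N + n)..<real (N + n)}" by (auto simp: E_def)
      have "emeasure lborel ?Z \<le> 0"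
      proof (rule ennreal_le_epsilon)
        fix e :: real assume "0 < e"
        show "emeasure lborel ?Z \<le> 0 + ennreal e"
          unfolding add_0
          by (rule emeasure_divergence_le[OF L dense c F Ffin \<open>E N \<in> sets borel\<close> sub N int \<open>0 < e\<close>])
      qed
      moreover have "?Z \<in> sets lborel" by measurable
      ultimately show ?thesis by (simp only: null_sets_def mem_Collect_eq le_zero_eq simp_thms)
    qed
    then have "AE x in lborel. \<forall>n. x \<notin> {x \<in> {-real (N + n)..<real (N + n)}. translate_sum F L x = \<infinity>}"
      by (simp only: AE_all_countable AE_not_in simp_thms)
    then have "AE x in lborel. translate_sum F L x < \<infinity>"
    proof eventually_elim
      case (elim x)
      obtain n where "\<bar>x\<bar> + 1 \<le> real n" using real_arch_simple by blast
      then have "x \<in> {-real (N + n)..<real (N + n)}" by auto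
      with elim show ?case by (auto simp: less_top)
    qed
    then show ?thesis ..
  qed
qed

section \<open>Passage to type 1\<close>

text \<open>Density at \<open>m = 0\<close> puts a point of \<open>L\<close> in
  \<open>[k, k + 1)\<close> for all large \<open>k\<close>. Discreteness is inherited from the local
  finiteness of \<open>Lambda_tilde\<close>.\<close>

lemma dyadically_dense_unbounded_discrete:
  assumes L: "L \<subseteq> Lambda_tilde" and dense: "dyadically_dense c L" and c: "c > 0"
  shows "unbounded_discrete L"
proof -
  have pos: "L \<subseteq> {0..}" using L by (auto simp: Lambda_tilde_def)
  have unb: "\<not> bounded L"
  proof
    assume "bounded L"
    then obtain b where b: "\<And>x. x \<in> L \<Longrightarrow> \<bar>x\<bar> \<le> b" by (auto simp: bounded_iff)
    have "\<forall>\<^sub>F k in sequentially. c * 2 ^ k \<le> real (card (L \<inter> dyadic_ivl 0 (int k)))"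
      using dense[unfolded dyadically_dense_def, rule_format, of 0] by (rule eventually_mono) simp
    then have "\<forall>\<^sub>F k in sequentially. c * 2 ^ k \<le> real (card (L \<inter> dyadic_ivl 0 (int k))) \<and> b + 1 \<le> real k"
      using eventually_ge_at_top[of "nat \<lceil>b + 1\<rceil>"] by eventually_elim linarith
    then obtain k where k: "c * 2 ^ k \<le> real (card (L \<inter> dyadic_ivl 0 (int k)))" "b + 1 \<le> real k"
      unfolding eventually_sequentially by blast
    have "0 < c * 2 ^ k" using c by simp
    then have "L \<inter> dyadic_ivl 0 (int k) \<noteq> {}" using k(1) by (metis card.empty not_le of_nat_0)
    then obtain x where "x \<in> L" "real k \<le> x" by (auto simp: dyadic_ivl_def)
    then show False using b[of x] k(2) by linarith
  qed
  have "x isolated_in L" if x: "x \<in> L" for x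
  proof -
    let ?T = "{..<x + 1} - (L \<inter> {..x + 1} - {x})"
    have "finite (L \<inter> {..x + 1} - {x})"
      using finite_Lambda_tilde_atMost[of "x + 1"] by (rule rev_finite_subset) (use L in auto)
    then have "open ?T" by (intro open_Diff finite_imp_closed) auto
    moreover have "?T \<inter> L = {x}" using x by auto
    ultimately show ?thesis using x unfolding isolated_in_def by blast
  qed
  then show ?thesis
    using pos unb finite_imp_bounded unfolding unbounded_discrete_def discrete_def by blast
qed

lemma AE_lborel_translate:
  fixes a :: real
  assumes "AE x in lborel. P x"
  shows "AE x in lborel. P (x + a)"
proof -
  have "AE x in distr lborel borel ((+) a). P x" unfolding lborel_distr_plus by (rule assms)
  then have "AE x in lborel. P (a + x)" by (rule AE_distrD[rotated]) simp
  then show ?thesis by (simp add: add.commute)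
qed

lemma AE_lborel_null_sets_lebesgue:
  assumes "AE x in lborel. x \<notin> A"
  shows "A \<in> null_sets lebesgue"
proof -
  obtain N where "A \<subseteq> N" "N \<in> null_sets lborel"
    using assms by (auto elim!: AE_E simp: null_sets_def)
  then show ?thesis by (blast intro: null_sets_completion_subset null_sets_completionI)
qed

text \<open>A Lebesgue measurable \<open>f\<close> agrees almost everywhere with a Borel function
  \<open>g\<close>. As \<open>L\<close> is countable, all translates by points of \<open>L\<close>
  agree simultaneously outside one null set, so the Borel case applies.\<close>

lemma dyadically_dense_type1:
  assumes L: "L \<subseteq> Lambda_tilde" and dense: "dyadically_dense c L" and c: "c > 0"
  shows "type1 L"
  unfolding type1_def
proof (intro conjI allI impI)
  show "unbounded_discrete L" using assms by (rule dyadically_dense_unbounded_discrete)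
  fix f :: "real \<Rightarrow> real" assume f: "f \<in> borel_measurable lebesgue \<and> (\<forall>x. f x \<ge> 0)"
  have cL: "countable L" using L countable_Lambda_tilde countable_subset by blast
  obtain g where g: "g \<in> borel_measurable lborel" "AE x in lborel. f x = g x"
    using completion_ex_borel_measurable_real[of f lborel] f by blast
  have "AE x in lborel. \<forall>l\<in>L. f (x + l) = g (x + l)"
    using cL by (simp add: AE_ball_countable AE_lborel_translate[OF g(2)])
  \<comment> \<open>\<open>g\<close> may be negative on a null set; \<open>ennreal\<close> sends
    such values to 0, so \<open>ennreal (g x)\<close> is a finite nonnegative function
    everywhere.\<close>
  then have eq: "AE x in lborel. x \<in> conv_set f L \<longleftrightarrow> translate_sum (\<lambda>x. ennreal (g x)) L x < \<infinity>"
  proof eventually_elim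
    case (elim x)
    have "(\<integral>\<^sup>+l. ennreal (f (x + l)) \<partial>count_space L) = translate_sum (\<lambda>x. ennreal (g x)) L x"
      unfolding translate_sum_def by (intro nn_integral_cong) (use elim in simp)
    then show ?case by (simp add: conv_set_def infsum_eq_nn_integral_count_space[OF cL])
  qed
  from zero_one_borel[OF L dense c, of "\<lambda>x. ennreal (g x)"] g(1)
  have "(AE x in lborel. translate_sum (\<lambda>x. ennreal (g x)) L x = \<infinity>) \<or>
      (AE x in lborel. translate_sum (\<lambda>x. ennreal (g x)) L x < \<infinity>)" by simp
  then show "- conv_set f L \<in> null_sets lebesgue \<or> conv_set f L \<in> null_sets lebesgue"
  proof
    assume "AE x in lborel. translate_sum (\<lambda>x. ennreal (g x)) L x = \<infinity>"
    with eq have "AE x in lborel. x \<notin> conv_set f L" by eventually_elim simp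
    then show ?thesis by (blast intro: AE_lborel_null_sets_lebesgue)
  next
    assume "AE x in lborel. translate_sum (\<lambda>x. ennreal (g x)) L x < \<infinity>"
    with eq have "AE x in lborel. x \<notin> - conv_set f L" by eventually_elim simp
    then show ?thesis by (blast intro: AE_lborel_null_sets_lebesgue)
  qed
qed

theorem theorem4p3:
  fixes p :: real
  assumes "0 < p" and "p < 1"
  shows "AE \<omega> in selection_measure p. type1 (selected Lambda_tilde \<omega>)"
proof -
  obtain c where c: "c > 0" "AE \<omega> in selection_measure p. dyadically_dense c (selected Lambda_tilde \<omega>)"
    using assms by (rule AE_dyadically_dense)
  have "selected Lambda_tilde \<omega> \<subseteq> Lambda_tilde" for \<omega>
    using increasing_enum_Lambda_tilde(2) by (auto simp: selected_def)
  note type1 = dyadically_dense_type1[OF this _ c(1)]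
  show ?thesis using c(2)
  proof eventually_elim
    case (elim \<omega>)
    then show ?case by (rule type1)
  qed
qed

end
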